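(* Let $g_1,g_1^\delta\in V^{1/2}(\Gamma)$ and $g_2,g_2^\delta\in V^{-1/2}(\Gamma)$ satisfy $$\|g_1^\delta-g_1\|_{V^{1/2}(\Gamma)}+\|g_2^\delta-g_2\|_{V^{-1/2}(\Gamma)}\le\delta,$$ where $\delta>0$. Let $y=\widetilde u_N(g_2)-\widetilde u_D(g_1)$ and $y^\delta=\widetilde u_N(g_2^\delta)-\widetilde u_D(g_1^\delta)$. Then $\|y^\delta-y\|_V\le\delta$.
   Context: $\Omega\subset\mathbb R^n$ ($n=2,3$) is a bounded open domain with Lipschitz boundary $\Gamma$. $D\in L^\infty(\Omega)$ with $D\ge D_0$ a.e. in $\Omega$, and $\mu_a\in L^2(\Omega)$ with $\mu_a\ge\mu_0$ a.e. in $\Omega$, where $D_0,\mu_0>0$ are constants. Set $$a(u,v)=\langle u,v\rangle_V=\int_\Omega(D\nabla u\cdot\nabla v+\mu_auv)\,dx,\qquad \|u\|_V=\sqrt{\langle u,u\rangle_V},$$ let $V$ be the (weighted $H^1(\Omega)$) space of functions $u$ with $\|u\|_V<\infty$, and $V_0=\{u\in V:u=0\text{ a.e. on }\Gamma\}$. Let $\gamma_0:V\to V^{1/2}(\Gamma)$ be the trace operator, where the trace space $V^{1/2}(\Gamma)$ has the norm $\|v\|_{V^{1/2}(\Gamma)}=\inf\{\|u\|_V:u\in V,\ \gamma_0u=v\}$. $V^{-1/2}(\Gamma)$ is the dual of $V^{1/2}(\Gamma)$ with norm $\|v\|_{V^{-1/2}(\Gamma)}=\sup_{0\ne w\in V^{1/2}(\Gamma)}\langle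 v,w\rangle/\|w\|_{V^{1/2}(\Gamma)}$, where $\langle\cdot,\cdot\rangle$ is the duality pairing. For $g_1\in V^{1/2}(\Gamma)$, $\widetilde u_D(g_1)$ is the unique $u\in V$ with $\gamma_0u=g_1$ and $a(u,v)=0$ for all $v\in V_0$. For $g_2\in V^{-1/2}(\Gamma)$, $\widetilde u_N(g_2)$ is the unique $u\in V$ with $a(u,v)=\langle g_2,\gamma_0v\rangle$ for all $v\in V$. *)

theory Defs
  imports "HOL-Analysis.Analysis"
begin

section \<open>Lipschitz boundaries and surface measure\<close>

text \<open>Near each boundary point the set is the strict epigraph of a Lipschitz function in suitable
  orthonormal coordinates. The unit vector \<open>e\<close> is the vertical direction; the hyperplane
  orthogonal to \<open>e\<close> stands for the space of the remaining \<open>n - 1\<close> coordinates, and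
  \<open>y - (y \<bullet> e) *\<^sub>R e\<close> is the projection of \<open>y\<close> onto it.\<close>

definition lipschitz_boundary :: "(real^'n) set \<Rightarrow> bool" where
  "lipschitz_boundary \<Omega> \<longleftrightarrow>
     (\<forall>x\<in>frontier \<Omega>. \<exists>r>0. \<exists>e. \<exists>h :: real^'n \<Rightarrow> real. \<exists>L.
        norm e = 1 \<and> L-lipschitz_on {z. z \<bullet> e = 0} h \<and>
        (\<forall>y\<in>ball x r. y \<in> \<Omega> \<longleftrightarrow> h (y - (y \<bullet> e) *\<^sub>R e) < y \<bullet> e))"

text \<open>Hausdorff outer measure of integer dimension \<open>s \<ge> 1\<close>, normalised so that it agrees with
  \<open>s\<close>-dimensional area. (For \<open>s = 0\<close> the empty set would be given the weight
  \<open>0 ^ 0 = 1\<close>.)\<close>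

definition hausdorff_outer :: "nat \<Rightarrow> 'a::metric_space set \<Rightarrow> ennreal" where
  "hausdorff_outer s A =
     (SUP d\<in>{0::real<..}.
        INF C\<in>{C :: nat \<Rightarrow> 'a set. A \<subseteq> (\<Union>i. C i) \<and> (\<forall>i. bounded (C i) \<and> diameter (C i) \<le> d)}.
          \<Sum>i. ennreal (unit_ball_vol (real s) * (diameter (C i) / 2) ^ s))"

text \<open>The outer measure is metric, hence countably additive on the Borel sets by
  Caratheodory's criterion; so \<open>measure_of\<close> does not collapse to the zero measure.\<close>

definition hausdorff_measure :: "nat \<Rightarrow> 'a::metric_space measure" where
  "hausdorff_measure s = measure_of UNIV (sets borel) (hausdorff_outer s)"

definition boundary_measure :: "(real^'n) set \<Rightarrow> (real^'n) measure" where
  "boundary_measure \<Omega> = restrict_space (hausdorff_measure (CARD('n) - 1)) (frontier \<Omega>)"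


section \<open>Weak gradients\<close>

definition partial_deriv :: "'n \<Rightarrow> (real^'n \<Rightarrow> real) \<Rightarrow> real^'n \<Rightarrow> real" where
  "partial_deriv i f x = frechet_derivative f (at x) (axis i 1)"

primrec C_k :: "nat \<Rightarrow> (real^'n \<Rightarrow> real) \<Rightarrow> bool" where
  "C_k 0 f \<longleftrightarrow> continuous_on UNIV f"
| "C_k (Suc k) f \<longleftrightarrow> (\<forall>x. f differentiable (at x)) \<and> (\<forall>i. C_k k (partial_deriv i f))"

definition test_function :: "(real^'n) set \<Rightarrow> (real^'n \<Rightarrow> real) \<Rightarrow> bool" where
  "test_function \<Omega> \<phi> \<longleftrightarrow>
     (\<forall>k. C_k k \<phi>) \<and> compact (closure {x. \<phi> x \<noteq> 0}) \<and> closure {x. \<phi> x \<noteq> 0} \<subseteq> \<Omega>"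

definition locally_integrable_on ::
    "(real^'n \<Rightarrow> 'b::euclidean_space) \<Rightarrow> (real^'n) set \<Rightarrow> bool" where
  "locally_integrable_on f \<Omega> \<longleftrightarrow>
     (\<forall>K. compact K \<and> K \<subseteq> \<Omega> \<longrightarrow> f absolutely_integrable_on K)"

definition is_weak_gradient ::
    "(real^'n) set \<Rightarrow> (real^'n \<Rightarrow> real) \<Rightarrow> (real^'n \<Rightarrow> real^'n) \<Rightarrow> bool" where
  "is_weak_gradient \<Omega> u p \<longleftrightarrow>
     locally_integrable_on u \<Omega> \<and> locally_integrable_on p \<Omega> \<and>
     (\<forall>\<phi> i. test_function \<Omega> \<phi> \<longrightarrow>
        (LINT x|lebesgue_on \<Omega>. u x * partial_deriv i \<phi> x) =
        - (LINT x|lebesgue_on \<Omega>. p x $ i * \<phi> x))"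

definition weakly_differentiable :: "(real^'n) set \<Rightarrow> (real^'n \<Rightarrow> real) \<Rightarrow> bool" where
  "weakly_differentiable \<Omega> u \<longleftrightarrow> (\<exists>p. is_weak_gradient \<Omega> u p)"

text \<open>Functions are representatives of their almost-everywhere classes throughout. The weak
  gradient is unique only up to null sets, so the choice below picks a representative.\<close>

definition weak_gradient :: "(real^'n) set \<Rightarrow> (real^'n \<Rightarrow> real) \<Rightarrow> real^'n \<Rightarrow> real^'n" where
  "weak_gradient \<Omega> u = (SOME p. is_weak_gradient \<Omega> u p)"


section \<open>The weighted Sobolev space and the trace operator\<close>

definition energy_form :: "(real^'n) set \<Rightarrow> (real^'n \<Rightarrow> real) \<Rightarrow> (real^'n \<Rightarrow> real) \<Rightarrow>
    (real^'n \<Rightarrow> real) \<Rightarrow> (real^'n \<Rightarrow> real) \<Rightarrow> real" where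
  "energy_form \<Omega> D \<mu> u v =
     (LINT x|lebesgue_on \<Omega>.
        D x * (weak_gradient \<Omega> u x \<bullet> weak_gradient \<Omega> v x) + \<mu> x * u x * v x)"

definition V_norm :: "(real^'n) set \<Rightarrow> (real^'n \<Rightarrow> real) \<Rightarrow> (real^'n \<Rightarrow> real) \<Rightarrow>
    (real^'n \<Rightarrow> real) \<Rightarrow> real" where
  "V_norm \<Omega> D \<mu> u = sqrt (energy_form \<Omega> D \<mu> u u)"

text \<open>For weights that are nonnegative almost everywhere, integrability of the energy density is
  exactly finiteness of \<open>V_norm\<close>, which as a Bochner integral would be \<open>0\<close>
  when the energy is infinite.\<close>

definition V_space :: "(real^'n) set \<Rightarrow> (real^'n \<Rightarrow> real) \<Rightarrow> (real^'n \<Rightarrow> real) \<Rightarrow>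
    (real^'n \<Rightarrow> real) set" where
  "V_space \<Omega> D \<mu> = {u. weakly_differentiable \<Omega> u \<and>
     integrable (lebesgue_on \<Omega>)
       (\<lambda>x. D x * (weak_gradient \<Omega> u x \<bullet> weak_gradient \<Omega> u x) + \<mu> x * u x * u x)}"

abbreviation H1_space :: "(real^'n) set \<Rightarrow> (real^'n \<Rightarrow> real) set" where
  "H1_space \<Omega> \<equiv> V_space \<Omega> (\<lambda>_. 1) (\<lambda>_. 1)"

abbreviation H1_norm :: "(real^'n) set \<Rightarrow> (real^'n \<Rightarrow> real) \<Rightarrow> real" where
  "H1_norm \<Omega> \<equiv> V_norm \<Omega> (\<lambda>_. 1) (\<lambda>_. 1)"

definition L2_space :: "'a measure \<Rightarrow> ('a \<Rightarrow> real) set" where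
  "L2_space M = {f \<in> borel_measurable M. integrable M (\<lambda>x. (f x)\<^sup>2)}"

definition Linfty_space :: "'a measure \<Rightarrow> ('a \<Rightarrow> real) set" where
  "Linfty_space M = {f \<in> borel_measurable M. \<exists>C. AE x in M. \<bar>f x\<bar> \<le> C}"

text \<open>The trace operator: the bounded linear map from \<open>H\<^sup>1(\<Omega>)\<close> to \<open>L\<^sup>2(\<Gamma>)\<close>
  that restricts functions continuous up to the boundary. On a bounded Lipschitz domain it exists
  and, by density of these functions, is unique.\<close>

definition is_trace_operator ::
    "(real^'n) set \<Rightarrow> ((real^'n \<Rightarrow> real) \<Rightarrow> real^'n \<Rightarrow> real) \<Rightarrow> bool" where
  "is_trace_operator \<Omega> \<gamma> \<longleftrightarrow>
     (\<forall>u\<in>H1_space \<Omega>. \<gamma> u \<in> L2_space (boundary_measure \<Omega>)) \<and>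
     (\<forall>u\<in>H1_space \<Omega>. \<forall>v\<in>H1_space \<Omega>. \<forall>a b.
        AE x in boundary_measure \<Omega>. \<gamma> (\<lambda>y. a * u y + b * v y) x = a * \<gamma> u x + b * \<gamma> v x) \<and>
     (\<exists>C. \<forall>u\<in>H1_space \<Omega>.
        sqrt (LINT x|boundary_measure \<Omega>. (\<gamma> u x)\<^sup>2) \<le> C * H1_norm \<Omega> u) \<and>
     (\<forall>u\<in>H1_space \<Omega>. continuous_on (closure \<Omega>) u \<longrightarrow>
        (AE x in boundary_measure \<Omega>. \<gamma> u x = u x))"

definition V0_space :: "(real^'n) set \<Rightarrow> (real^'n \<Rightarrow> real) \<Rightarrow> (real^'n \<Rightarrow> real) \<Rightarrow>
    ((real^'n \<Rightarrow> real) \<Rightarrow> real^'n \<Rightarrow> real) \<Rightarrow> (real^'n \<Rightarrow> real) set" where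
  "V0_space \<Omega> D \<mu> \<gamma> = {u \<in> V_space \<Omega> D \<mu>. AE x in boundary_measure \<Omega>. \<gamma> u x = 0}"


section \<open>Trace space and its dual\<close>

definition trace_space :: "(real^'n) set \<Rightarrow> (real^'n \<Rightarrow> real) \<Rightarrow> (real^'n \<Rightarrow> real) \<Rightarrow>
    ((real^'n \<Rightarrow> real) \<Rightarrow> real^'n \<Rightarrow> real) \<Rightarrow> (real^'n \<Rightarrow> real) set" where
  "trace_space \<Omega> D \<mu> \<gamma> =
     {g. \<exists>u\<in>V_space \<Omega> D \<mu>. AE x in boundary_measure \<Omega>. \<gamma> u x = g x}"

definition trace_norm :: "(real^'n) set \<Rightarrow> (real^'n \<Rightarrow> real) \<Rightarrow> (real^'n \<Rightarrow> real) \<Rightarrow>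
    ((real^'n \<Rightarrow> real) \<Rightarrow> real^'n \<Rightarrow> real) \<Rightarrow> (real^'n \<Rightarrow> real) \<Rightarrow> real" where
  "trace_norm \<Omega> D \<mu> \<gamma> g =
     (INF u\<in>{u \<in> V_space \<Omega> D \<mu>. AE x in boundary_measure \<Omega>. \<gamma> u x = g x}. V_norm \<Omega> D \<mu> u)"

text \<open>Boundedness with respect to \<open>trace_norm\<close> makes these functionals independent of the
  representative.\<close>

definition dual_space :: "(real^'n) set \<Rightarrow> (real^'n \<Rightarrow> real) \<Rightarrow> (real^'n \<Rightarrow> real) \<Rightarrow>
    ((real^'n \<Rightarrow> real) \<Rightarrow> real^'n \<Rightarrow> real) \<Rightarrow> ((real^'n \<Rightarrow> real) \<Rightarrow> real) set" where
  "dual_space \<Omega> D \<mu> \<gamma> =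
     {F. (\<forall>v\<in>trace_space \<Omega> D \<mu> \<gamma>. \<forall>w\<in>trace_space \<Omega> D \<mu> \<gamma>. \<forall>a b.
            F (\<lambda>x. a * v x + b * w x) = a * F v + b * F w) \<and>
         (\<exists>C. \<forall>w\<in>trace_space \<Omega> D \<mu> \<gamma>. \<bar>F w\<bar> \<le> C * trace_norm \<Omega> D \<mu> \<gamma> w)}"

definition dual_norm :: "(real^'n) set \<Rightarrow> (real^'n \<Rightarrow> real) \<Rightarrow> (real^'n \<Rightarrow> real) \<Rightarrow>
    ((real^'n \<Rightarrow> real) \<Rightarrow> real^'n \<Rightarrow> real) \<Rightarrow> ((real^'n \<Rightarrow> real) \<Rightarrow> real) \<Rightarrow> real" where
  "dual_norm \<Omega> D \<mu> \<gamma> F =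
     (SUP w\<in>{w \<in> trace_space \<Omega> D \<mu> \<gamma>. \<not> (AE x in boundary_measure \<Omega>. w x = 0)}.
        F w / trace_norm \<Omega> D \<mu> \<gamma> w)"


section \<open>Dirichlet and Neumann solutions\<close>

text \<open>Both problems are uniquely solvable up to null sets; the choice picks a representative of
  the solution.\<close>

definition dirichlet_solution :: "(real^'n) set \<Rightarrow> (real^'n \<Rightarrow> real) \<Rightarrow> (real^'n \<Rightarrow> real) \<Rightarrow>
    ((real^'n \<Rightarrow> real) \<Rightarrow> real^'n \<Rightarrow> real) \<Rightarrow> (real^'n \<Rightarrow> real) \<Rightarrow> real^'n \<Rightarrow> real" where
  "dirichlet_solution \<Omega> D \<mu> \<gamma> g =
     (SOME u. u \<in> V_space \<Omega> D \<mu> \<and>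
        (AE x in boundary_measure \<Omega>. \<gamma> u x = g x) \<and>
        (\<forall>v\<in>V0_space \<Omega> D \<mu> \<gamma>. energy_form \<Omega> D \<mu> u v = 0))"

definition neumann_solution :: "(real^'n) set \<Rightarrow> (real^'n \<Rightarrow> real) \<Rightarrow> (real^'n \<Rightarrow> real) \<Rightarrow>
    ((real^'n \<Rightarrow> real) \<Rightarrow> real^'n \<Rightarrow> real) \<Rightarrow> ((real^'n \<Rightarrow> real) \<Rightarrow> real) \<Rightarrow> real^'n \<Rightarrow> real" where
  "neumann_solution \<Omega> D \<mu> \<gamma> F =
     (SOME u. u \<in> V_space \<Omega> D \<mu> \<and>
        (\<forall>v\<in>V_space \<Omega> D \<mu>. energy_form \<Omega> D \<mu> u v = F (\<gamma> v)))"

end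

theory Submission
  imports Defs
begin

text \<open>Both boundary value problems are linear, so \<open>y\<delta> - y\<close> is \<open>u - d\<close>, where \<open>u\<close> is the Neumann solution
for the perturbation \<open>g2\<delta> - g2\<close> and \<open>d\<close> the Dirichlet solution for \<open>g1\<delta> - g1\<close>. By the triangle
inequality it is enough to bound each part by the norm of its own datum, and both norms are made for this.
The function \<open>d\<close> is orthogonal to \<open>V\<^sub>0\<close>, hence by Pythagoras it has the least energy norm among all functions with
its trace; so \<open>d\<close> realises the infimum that defines the trace norm
(\<open>orthogonal_to_V0_minimises_norm\<close>). For \<open>u\<close>, testing with \<open>u\<close> itself gives
\<open>\<parallel>u\<parallel>\<^sup>2 = \<langle>g, \<gamma> u\<rangle> \<le> \<parallel>g\<parallel> \<parallel>\<gamma> u\<parallel> \<le> \<parallel>g\<parallel> \<parallel>u\<parallel>\<close>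
(\<open>neumann_norm_le\<close>). If every trace vanishes, the dual norm is a supremum over the empty set and
carries no information; but then \<open>V\<^sub>0 = V\<close> and \<open>u\<close> and \<open>d\<close> both have norm zero (\<open>stability\<close>).

The solutions are obtained by choice, so this argument needs their existence, and that is where the analysis
lies. It follows from the Riesz theorem (\<open>riesz\<close>), applied on \<open>V\<close> for the Neumann problem and on \<open>V\<^sub>0\<close> for
the Dirichlet problem. Its hypotheses rest on two facts:

  \<^item> The energy is a bilinear form only if the chosen weak gradients are linear up to null sets. This
    is the uniqueness of weak gradients (\<open>is_weak_gradient_unique\<close>), that is, the fundamental lemma of the
    calculus of variations, for which enough smooth compactly supported functions have to be built.

  \<^item> \<open>V\<close> is complete (\<open>V_complete\<close>): a rapidly Cauchy sequence converges almost everywhere together with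
    its gradients, dominated convergence identifies the weak gradient of the limit, and the lemma of Fatou
    turns the Cauchy bounds into bounds on the distance to the limit. The space \<open>V\<^sub>0\<close> is closed because
    the trace is bounded.\<close>

section \<open>Riesz representation in a complete semi-inner product space\<close>

text \<open>The energy form vanishes on functions that are zero almost everywhere, so it is only a semi-inner product on
representatives. Vectors are real functions with pointwise
operations, and linear subspaces are sets closed under the two-term combinations that the definitions of
the dual space and of the trace operator use.\<close>

locale semi_inner_space =
  fixes V :: "('a \<Rightarrow> real) set" and B :: "('a \<Rightarrow> real) \<Rightarrow> ('a \<Rightarrow> real) \<Rightarrow> real"
  assumes nonempty: "V \<noteq> {}"
    and lincomb: "u \<in> V \<Longrightarrow> v \<in> V \<Longrightarrow> (\<lambda>x. a * u x + b * v x) \<in> V"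
    and sym: "u \<in> V \<Longrightarrow> v \<in> V \<Longrightarrow> B u v = B v u"
    and lincomb_left: "u \<in> V \<Longrightarrow> v \<in> V \<Longrightarrow> w \<in> V \<Longrightarrow>
      B (\<lambda>x. a * u x + b * v x) w = a * B u w + b * B v w"
    and nonneg: "v \<in> V \<Longrightarrow> 0 \<le> B v v"
begin

lemma lincomb_right:
  "u \<in> V \<Longrightarrow> v \<in> V \<Longrightarrow> w \<in> V \<Longrightarrow> B w (\<lambda>x. a * u x + b * v x) = a * B w u + b * B w v"
  by (simp add: lincomb_left sym[of w] lincomb)

lemma lincomb_diag:
  assumes "u \<in> V" "v \<in> V"
  shows "B (\<lambda>x. a * u x + b * v x) (\<lambda>x. a * u x + b * v x) =
    a\<^sup>2 * B u u + 2 * a * b * B u v + b\<^sup>2 * B v v"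
  using assms by (simp add: lincomb lincomb_left lincomb_right sym[of v u] power2_eq_square algebra_simps)

lemma diff: "u \<in> V \<Longrightarrow> v \<in> V \<Longrightarrow> u - v \<in> V"
  using lincomb[of u v 1 "-1"] by (simp add: fun_diff_def)

lemma diff_left: "u \<in> V \<Longrightarrow> v \<in> V \<Longrightarrow> w \<in> V \<Longrightarrow> B (u - v) w = B u w - B v w"
  using lincomb_left[of u v w 1 "-1"] by (simp add: fun_diff_def)

lemma diff_right: "u \<in> V \<Longrightarrow> v \<in> V \<Longrightarrow> w \<in> V \<Longrightarrow> B w (u - v) = B w u - B w v"
  using lincomb_right[of u v w 1 "-1"] by (simp add: fun_diff_def)

lemma diff_diag:
  "u \<in> V \<Longrightarrow> v \<in> V \<Longrightarrow> B (u - v) (u - v) = B u u - 2 * B u v + B v v"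
  using lincomb_diag[of u v 1 "-1"] by (simp add: fun_diff_def)

lemma cauchy_schwarz:
  assumes "u \<in> V" "v \<in> V"
  shows "\<bar>B u v\<bar> \<le> sqrt (B u u) * sqrt (B v v)"
proof -
  have q: "0 \<le> s\<^sup>2 * B u u + 2 * s * B u v + B v v" for s
    using nonneg[OF lincomb[OF assms, of s 1]] lincomb_diag[OF assms, of s 1] by simp
  have "(B u v)\<^sup>2 \<le> B u u * B v v"
  proof (cases "B u u = 0")
    case True
    have "B u v = 0"
    proof (rule ccontr)
      assume "B u v \<noteq> 0"
      then show False
        using q[of "- (B v v + 1) / (2 * B u v)"] True by (simp add: field_simps)
    qed
    then show ?thesis using True by simp
  next
    case False
    then have "0 < B u u" using nonneg[OF assms(1)] by simp
    then show ?thesis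
      using q[of "- B u v / B u u"] by (simp add: field_simps power2_eq_square)
  qed
  then have "sqrt ((B u v)\<^sup>2) \<le> sqrt (B u u * B v v)" by (rule real_sqrt_le_mono)
  then show ?thesis by (simp add: real_sqrt_mult)
qed

lemma triangle_diff:
  assumes "u \<in> V" "v \<in> V"
  shows "sqrt (B (u - v) (u - v)) \<le> sqrt (B u u) + sqrt (B v v)"
proof (rule real_le_lsqrt)
  show "0 \<le> sqrt (B u u) + sqrt (B v v)" using nonneg assms by simp
  show "B (u - v) (u - v) \<le> (sqrt (B u u) + sqrt (B v v))\<^sup>2"
    using cauchy_schwarz[OF assms] nonneg assms by (simp add: diff_diag power2_sum)
qed

text \<open>Convergence in the seminorm implies weak convergence, by the Cauchy--Schwarz inequality.\<close>

lemma tendsto_left: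
  assumes V: "\<And>n. v n \<in> V" "u \<in> V" "w \<in> V"
    and lim: "(\<lambda>n. B (v n - u) (v n - u)) \<longlonglongrightarrow> 0"
  shows "(\<lambda>n. B (v n) w) \<longlonglongrightarrow> B u w"
proof -
  have "(\<lambda>n. sqrt (B (v n - u) (v n - u)) * sqrt (B w w)) \<longlonglongrightarrow> sqrt 0 * sqrt (B w w)"
    by (intro tendsto_intros lim)
  then have z: "(\<lambda>n. sqrt (B (v n - u) (v n - u)) * sqrt (B w w)) \<longlonglongrightarrow> 0"
    by simp
  have "(\<lambda>n. B (v n) w - B u w) \<longlonglongrightarrow> 0"
  proof (rule Lim_null_comparison[OF _ z], intro always_eventually allI)
    fix n
    show "norm (B (v n) w - B u w) \<le> sqrt (B (v n - u) (v n - u)) * sqrt (B w w)"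
      using cauchy_schwarz[OF diff[OF V(1) V(2)] V(3), of n] V by (simp add: diff_left)
  qed
  then show ?thesis using LIM_zero_iff by blast
qed

text \<open>The representing vector minimises \<open>J v = B v v - 2 * L v\<close>, which is bounded below because \<open>L\<close> is
bounded. The parallelogram law makes a minimising sequence Cauchy, and the rate at which its values
approach the infimum can be prescribed; it is chosen so that completeness is only required for sequences with
geometrically decreasing distances, which is the form that is easiest to verify for function spaces. At
the limit \<open>u\<close>, the quadratic polynomial \<open>t \<mapsto> J (u + t * w) - J u\<close> is nonnegative, so its linear coefficient
vanishes.\<close>

lemma riesz:
  assumes complete: "\<And>v. (\<And>n. v n \<in> V) \<Longrightarrow>
        (\<And>n k. n \<le> k \<Longrightarrow> B (v n - v k) (v n - v k) \<le> (1/4) ^ n) \<Longrightarrow>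
        \<exists>u\<in>V. (\<lambda>n. B (v n - u) (v n - u)) \<longlonglongrightarrow> 0"
    and linear: "\<And>u v a b. u \<in> V \<Longrightarrow> v \<in> V \<Longrightarrow> L (\<lambda>x. a * u x + b * v x) = a * L u + b * L v"
    and bounded: "\<And>v. v \<in> V \<Longrightarrow> \<bar>L v\<bar> \<le> C * sqrt (B v v)"
  shows "\<exists>u\<in>V. \<forall>v\<in>V. B u v = L v"
proof -
  define J where "J v = B v v - 2 * L v" for v
  have J_ge: "- C\<^sup>2 \<le> J v" if "v \<in> V" for v
  proof -
    have "0 \<le> (sqrt (B v v) - C)\<^sup>2" by simp
    also have "\<dots> = B v v - 2 * (C * sqrt (B v v)) + C\<^sup>2"
      using nonneg[OF that] by (simp add: power2_diff)
    also have "\<dots> \<le> J v + C\<^sup>2" using bounded[OF that] by (simp add: J_def)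
    finally show ?thesis by simp
  qed
  define m where "m = (INF v\<in>V. J v)"
  have m_le: "m \<le> J v" if "v \<in> V" for v
    unfolding m_def by (rule cINF_lower[OF bdd_belowI2[of V "- C\<^sup>2" J] that]) (rule J_ge)
  have "\<exists>v\<in>V. J v < m + (1/4) ^ Suc n" for n
  proof -
    have "(INF v\<in>V. J v) < m + (1/4) ^ Suc n" unfolding m_def by simp
    with cINF_less_iff[OF nonempty bdd_belowI2[of V "- C\<^sup>2" J]] J_ge show ?thesis by blast
  qed
  then obtain v where vV: "\<And>n. v n \<in> V" and vJ: "\<And>n. J (v n) < m + (1/4) ^ Suc n"
    by metis
  have "B (v n - v k) (v n - v k) \<le> (1/4) ^ n" if "n \<le> k" for n k
  proof -
    let ?h = "\<lambda>x. (1/2) * v n x + (1/2) * v k x"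
    have "4 * J ?h = B (v n) (v n) + 2 * B (v n) (v k) + B (v k) (v k) - 4 * (L (v n) + L (v k))"
      unfolding J_def by (simp only: lincomb_diag vV linear) (simp add: power2_eq_square algebra_simps)
    then have "B (v n - v k) (v n - v k) = 2 * J (v n) + 2 * J (v k) - 4 * J ?h"
      using vV by (simp add: diff_diag J_def)
    also have "\<dots> \<le> 2 * (1/4) ^ Suc n + 2 * (1/4) ^ Suc k"
      using m_le[OF lincomb[OF vV vV], of "1/2" n "1/2" k] vJ[of n] vJ[of k] by linarith
    also have "\<dots> \<le> 2 * (1/4) ^ Suc n + 2 * (1/4) ^ Suc n"
      using power_decreasing[of "Suc n" "Suc k" "1/4::real"] that
      by (simp only: add_left_mono mult_left_mono Suc_le_mono)
    finally show ?thesis by simp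
  qed
  from complete[OF vV this] obtain u where u: "u \<in> V"
    and lim: "(\<lambda>n. B (v n - u) (v n - u)) \<longlonglongrightarrow> 0" by blast
  have "B u w = L w" if w: "w \<in> V" for w
  proof -
    \<comment> \<open>The limit of \<open>m \<le> J (v n + t * w)\<close>; the error term bounds the distance of \<open>J (v n)\<close> from \<open>m\<close>.\<close>
    have q: "0 \<le> 2 * t * (B u w - L w) + t\<^sup>2 * B w w" for t
    proof (rule tendsto_lowerbound)
      show "(\<lambda>n. 2 * t * (B (v n) w - L w) + t\<^sup>2 * B w w + (1/4) ^ Suc n)
          \<longlonglongrightarrow> 2 * t * (B u w - L w) + t\<^sup>2 * B w w"
        using tendsto_add[OF tendsto_add[OF tendsto_mult[OF tendsto_const[of "2*t"]
            tendsto_diff[OF tendsto_left[OF vV u w lim] tendsto_const[of "L w"]]]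
            tendsto_const[of "t\<^sup>2 * B w w"]]
            LIMSEQ_Suc[OF LIMSEQ_power_zero[of "1/4::real"]]] by simp
      show "\<forall>\<^sub>F n in sequentially. 0 \<le> 2 * t * (B (v n) w - L w) + t\<^sup>2 * B w w + (1/4) ^ Suc n"
      proof (intro always_eventually allI)
        fix n
        have "m \<le> J (\<lambda>x. 1 * v n x + t * w x)" by (rule m_le[OF lincomb[OF vV w]])
        also have "\<dots> = J (v n) + (2 * t * (B (v n) w - L w) + t\<^sup>2 * B w w)"
          unfolding J_def by (simp only: lincomb_diag vV w linear) (simp add: algebra_simps)
        finally show "0 \<le> 2 * t * (B (v n) w - L w) + t\<^sup>2 * B w w + (1/4) ^ Suc n"
          using vJ[of n] by linarith
      qed
    qed simp
    define c where "c = B u w - L w"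
    have "c = 0"
    proof (rule ccontr)
      assume "c \<noteq> 0"
      \<comment> \<open>The summand 1 keeps the denominator positive when \<open>w\<close> has norm zero.\<close>
      define s where "s = B w w + 1"
      have s: "0 < s" "B w w = s - 1" using nonneg[OF w] by (auto simp: s_def)
      have "0 \<le> 2 * (- c / s) * c + (- c / s)\<^sup>2 * (s - 1)"
        using q[of "- c / s"] s unfolding c_def by simp
      then have "0 \<le> s\<^sup>2 * (2 * (- c / s) * c + (- c / s)\<^sup>2 * (s - 1))"
        by (intro mult_nonneg_nonneg) auto
      also have "\<dots> = - (c\<^sup>2 * (s + 1))"
        using \<open>0 < s\<close> by (simp add: power2_eq_square divide_simps) (simp add: algebra_simps)
      finally show False using \<open>0 < s\<close> \<open>c \<noteq> 0\<close> by (simp add: mult_le_0_iff)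
    qed
    then show ?thesis by (simp add: c_def)
  qed
  with u show ?thesis by blast
qed

end

section \<open>Smooth functions with compact support\<close>

lemma partial_deriv_eq:
  "(f has_derivative f') (at x) \<Longrightarrow> partial_deriv i f x = f' (axis i 1)"
  unfolding partial_deriv_def by (simp add: frechet_derivative_at[symmetric])

lemma partial_deriv_add:
  assumes "\<And>x. f differentiable (at x)" "\<And>x. g differentiable (at x)"
  shows "partial_deriv i (\<lambda>x. f x + g x) = (\<lambda>x. partial_deriv i f x + partial_deriv i g x)"
proof
  fix x
  have "((\<lambda>x. f x + g x) has_derivative
      (\<lambda>h. frechet_derivative f (at x) h + frechet_derivative g (at x) h)) (at x)"
    using assms by (intro has_derivative_add) (simp_all add: frechet_derivative_works[symmetric])
  from partial_deriv_eq[OF this]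
  show "partial_deriv i (\<lambda>x. f x + g x) x = partial_deriv i f x + partial_deriv i g x"
    by (simp add: partial_deriv_def)
qed

lemma partial_deriv_mult:
  assumes "\<And>x. f differentiable (at x)" "\<And>x. g differentiable (at x)"
  shows "partial_deriv i (\<lambda>x. f x * g x) =
    (\<lambda>x. f x * partial_deriv i g x + partial_deriv i f x * g x)"
proof
  fix x
  have "((\<lambda>x. f x * g x) has_derivative
      (\<lambda>h. f x * frechet_derivative g (at x) h + frechet_derivative f (at x) h * g x)) (at x)"
    using assms by (intro has_derivative_mult) (simp_all add: frechet_derivative_works[symmetric])
  from partial_deriv_eq[OF this]
  show "partial_deriv i (\<lambda>x. f x * g x) x = f x * partial_deriv i g x + partial_deriv i f x * g x"
    by (simp add: partial_deriv_def)
qed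

lemma C_k_Suc_imp_C_k: "C_k (Suc k) f \<Longrightarrow> C_k k f"
proof (induction k arbitrary: f)
  case 0
  then show ?case
    by (auto intro!: continuous_at_imp_continuous_on differentiable_imp_continuous_within)
next
  case (Suc k)
  then show ?case by (metis C_k.simps(2))
qed

lemma C_k_const: "C_k k (\<lambda>x. c)"
proof (induction k arbitrary: c)
  case (Suc k)
  have "partial_deriv i (\<lambda>x. c) = (\<lambda>x :: real^'a. 0)" for i
    by (rule ext, subst partial_deriv_eq[OF has_derivative_const]) simp
  with Suc show ?case by simp
qed simp

lemma C_k_add: "C_k k f \<Longrightarrow> C_k k g \<Longrightarrow> C_k k (\<lambda>x. f x + g x)"
proof (induction k arbitrary: f g)
  case 0
  then show ?case by (auto intro: continuous_intros)
next
  case (Suc k)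
  then show ?case by (auto simp: partial_deriv_add intro!: derivative_intros)
qed

lemma C_k_mult: "C_k k f \<Longrightarrow> C_k k g \<Longrightarrow> C_k k (\<lambda>x. f x * g x)"
proof (induction k arbitrary: f g)
  case 0
  then show ?case by (auto intro: continuous_intros)
next
  case (Suc k)
  note low = C_k_Suc_imp_C_k[OF Suc.prems(1)] C_k_Suc_imp_C_k[OF Suc.prems(2)]
  from Suc.prems have "\<And>i. C_k k (\<lambda>x. f x * partial_deriv i g x + partial_deriv i f x * g x)"
    by (intro C_k_add Suc.IH low) auto
  with Suc.prems show ?case by (auto simp: partial_deriv_mult intro!: derivative_intros)
qed

lemma C_k_prod: "finite I \<Longrightarrow> (\<And>i. i \<in> I \<Longrightarrow> C_k k (f i)) \<Longrightarrow> C_k k (\<lambda>x. \<Prod>i\<in>I. f i x)"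
  by (induction I rule: finite_induct) (simp_all add: C_k_const C_k_mult)

text \<open>The functions \<open>exp (- 1 / t) / t ^ m\<close>, extended by zero: as a family they are closed under
differentiation up to linear combinations, which makes smoothness of the first one an induction over all of them.\<close>

definition flat :: "nat \<Rightarrow> real \<Rightarrow> real" where
  "flat m t = (if 0 < t then exp (- 1 / t) / t ^ m else 0)"

lemma flat_tendsto_0: "(flat m \<longlongrightarrow> 0) (at 0)"
proof (rule filterlim_split_at)
  show "(flat m \<longlongrightarrow> 0) (at_left 0)"
    by (rule tendsto_eventually) (auto simp: flat_def eventually_at intro: exI[of _ 1])
  have "((\<lambda>t. (inverse t) ^ m / exp (inverse t)) \<longlongrightarrow> (0::real)) (at_right 0)"
    by (rule filterlim_compose[OF tendsto_power_div_exp_0 filterlim_inverse_at_top_right])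
  then show "(flat m \<longlongrightarrow> 0) (at_right 0)"
  proof (rule Lim_transform_eventually)
    show "\<forall>\<^sub>F t in at_right 0. inverse t ^ m / exp (inverse t) = flat m t"
      by (auto simp: flat_def eventually_at_filter exp_minus field_simps)
  qed
qed

lemma flat_has_derivative:
  "(flat m has_real_derivative flat (m + 2) t - real m * flat (m + 1) t) (at t)"
proof -
  consider "t < 0" | "t = 0" | "0 < t" by linarith
  then show ?thesis
  proof cases
    case 1
    have "((\<lambda>t. 0) has_real_derivative flat (m + 2) t - real m * flat (m + 1) t) (at t)"
      using 1 by (simp add: flat_def)
    then show ?thesis
      by (rule has_field_derivative_transform_within_open[where S = "{..<0}"])
        (use 1 in \<open>auto simp: flat_def\<close>)
  next
    case 2
    have "((\<lambda>h. (flat m (0 + h) - flat m 0) / h) \<longlongrightarrow> 0) (at 0)"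
    proof (rule Lim_transform_eventually[OF flat_tendsto_0[of "Suc m"]])
      show "\<forall>\<^sub>F h in at 0. flat (Suc m) h = (flat m (0 + h) - flat m 0) / h"
        by (auto simp: flat_def eventually_at_filter)
    qed
    then show ?thesis using 2 by (simp add: DERIV_def flat_def)
  next
    case 3
    have "((\<lambda>t. exp (- 1 / t) / t ^ m) has_real_derivative
        flat (m + 2) t - real m * flat (m + 1) t) (at t)"
      using 3
      by (auto intro!: derivative_eq_intros simp: flat_def divide_simps)
        (simp add: algebra_simps power2_eq_square, cases m, auto)
    then show ?thesis
      by (rule has_field_derivative_transform_within_open[where S = "{0<..}"])
        (use 3 in \<open>auto simp: flat_def\<close>)
  qed
qed

text \<open>The induction on \<open>k\<close> has to range over all \<open>m\<close>, as each derivative raises the exponent.\<close>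

lemma C_k_flat: "C_k k (\<lambda>x :: real^'n. flat m (c * x $ i + d))"
proof (induction k arbitrary: m)
  case 0
  have "continuous_on UNIV (flat m)"
    by (intro continuous_at_imp_continuous_on ballI DERIV_isCont[OF flat_has_derivative])
  then have "continuous_on UNIV (\<lambda>x :: real^'n. flat m (c * x $ i + d))"
    by (rule continuous_on_compose2) (auto intro!: continuous_intros)
  then show ?case by simp
next
  case (Suc k)
  have D: "((\<lambda>x :: real^'n. flat m (c * x $ i + d)) has_derivative
     (\<lambda>h. (flat (m + 2) (c * x $ i + d) - real m * flat (m + 1) (c * x $ i + d)) * (c * h $ i))) (at x)"
    for x
  proof -
    have "((\<lambda>x :: real^'n. c * x $ i + d) has_derivative (\<lambda>h. c * h $ i)) (at x)"
      by (auto intro!: derivative_eq_intros bounded_linear.has_derivative[OF bounded_linear_vec_nth])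
    from DERIV_compose_FDERIV[OF flat_has_derivative this] show ?thesis
      by (simp add: mult.commute)
  qed
  have "C_k k (\<lambda>x :: real^'n. (flat (m + 2) (c * x $ i + d) + (- real m) * flat (m + 1) (c * x $ i + d))
       * (c * axis j 1 $ i))" for j
    by (intro C_k_mult C_k_add C_k_const Suc)
  with D show ?case
    by (auto simp: partial_deriv_eq[OF D, abs_def] differentiable_def)
qed

text \<open>For growing \<open>n\<close> the factors \<open>exp (- 1 / (n * t))\<close> tend to 1 wherever \<open>t > 0\<close>, so these smooth functions approximate
the indicator of an open box from below, without any mollification.\<close>

definition box_bump :: "real^'n \<Rightarrow> real^'n \<Rightarrow> nat \<Rightarrow> real^'n \<Rightarrow> real" where
  "box_bump a b n x =
     (\<Prod>i\<in>UNIV. flat 0 (real n * (x $ i - a $ i)) * flat 0 (real n * (b $ i - x $ i)))"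

lemma flat_0_bounds: "0 \<le> flat 0 t" "flat 0 t \<le> 1"
  by (auto simp: flat_def)

lemma box_bump_bounds: "0 \<le> box_bump a b n x" "box_bump a b n x \<le> 1"
  unfolding box_bump_def
  by (auto intro!: prod_nonneg prod_le_1 mult_le_one mult_nonneg_nonneg simp: flat_0_bounds)

lemma box_bump_outside: "x \<notin> box a b \<Longrightarrow> box_bump a b n x = 0"
proof -
  assume "x \<notin> box a b"
  then obtain i where "x $ i \<le> a $ i \<or> b $ i \<le> x $ i"
    by (auto simp: mem_box_cart not_less)
  then have "flat 0 (real n * (x $ i - a $ i)) * flat 0 (real n * (b $ i - x $ i)) = 0"
    by (auto simp: flat_def zero_less_mult_iff)
  then show ?thesis unfolding box_bump_def by (intro prod_zero) auto
qed

lemma box_bump_tendsto_indicator: "(\<lambda>n. box_bump a b n x) \<longlonglongrightarrow> indicator (box a b) x"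
proof (cases "x \<in> box a b")
  case True
  have flat1: "(\<lambda>n. flat 0 (real n * t)) \<longlonglongrightarrow> 1" if "0 < t" for t
  proof -
    have "(\<lambda>n. exp (- (1 / t) * inverse (real n))) \<longlonglongrightarrow> exp (- (1 / t) * 0)"
      by (intro tendsto_intros lim_inverse_n)
    moreover have "\<forall>\<^sub>F n in sequentially. exp (- (1 / t) * inverse (real n)) = flat 0 (real n * t)"
      using eventually_gt_at_top[of "0::nat"] by eventually_elim (use that in \<open>simp add: flat_def field_simps\<close>)
    ultimately show ?thesis by (simp add: tendsto_cong)
  qed
  have "(\<lambda>n. box_bump a b n x) \<longlonglongrightarrow> (\<Prod>i::'a\<in>UNIV. 1 * 1)"
    unfolding box_bump_def using True
    by (intro tendsto_prod tendsto_mult flat1) (auto simp: mem_box_cart)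
  then show ?thesis using True by simp
qed (simp add: box_bump_outside)

lemma test_function_box_bump:
  assumes "cbox a b \<subseteq> \<Omega>"
  shows "test_function \<Omega> (box_bump a b n)"
proof -
  have "box_bump a b n = (\<lambda>x. \<Prod>i\<in>UNIV. flat 0 (real n * x $ i + - (real n * a $ i)) *
      flat 0 (- real n * x $ i + real n * b $ i))"
    unfolding box_bump_def by (simp add: algebra_simps)
  then have "C_k k (box_bump a b n)" for k
    by (simp only:) (intro C_k_prod C_k_mult C_k_flat finite)
  moreover have "closure {x. box_bump a b n x \<noteq> 0} \<subseteq> cbox a b"
    using box_bump_outside box_subset_cbox by (intro closure_minimal closed_cbox) blast
  moreover from this have "compact (closure {x. box_bump a b n x \<noteq> 0})"
    by (metis closed_closure compact_Int_closed compact_cbox inf.absorb_iff2)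
  ultimately show ?thesis using assms by (auto simp: test_function_def)
qed

section \<open>The fundamental lemma of the calculus of variations and weak gradients\<close>

lemma locally_integrable_on_imp_measurable:
  assumes "open \<Omega>" "locally_integrable_on f \<Omega>"
  shows "f \<in> borel_measurable (lebesgue_on \<Omega>)"
proof -
  obtain C where C: "\<And>n. compact (C n)" "\<And>n. C n \<subseteq> \<Omega>" "\<And>n. C n \<subseteq> interior (C (Suc n))"
    "\<Union>(range C) = \<Omega>" "\<And>K. compact K \<Longrightarrow> K \<subseteq> \<Omega> \<Longrightarrow> \<exists>N. \<forall>n\<ge>N. K \<subseteq> C n"
    using open_Union_compact_subsets[OF assms(1)] by metis
  have "(\<lambda>x. indicator \<Omega> x *\<^sub>R f x) \<in> borel_measurable lebesgue"
  proof (rule borel_measurable_LIMSEQ_metric)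
    show "(\<lambda>x. indicator (C n) x *\<^sub>R f x) \<in> borel_measurable lebesgue" for n
      using assms(2) C(1,2) unfolding locally_integrable_on_def set_integrable_def
      by (blast intro: borel_measurable_integrable)
    show "(\<lambda>n. indicator (C n) x *\<^sub>R f x) \<longlonglongrightarrow> indicator \<Omega> x *\<^sub>R f x" for x
    proof (cases "x \<in> \<Omega>")
      case True
      then obtain N where "\<forall>n\<ge>N. x \<in> C n" using C(5)[of "{x}"] by auto
      then have "\<forall>n\<ge>N. indicator (C n) x *\<^sub>R f x = indicator \<Omega> x *\<^sub>R f x"
        using True by simp
      then have "\<forall>\<^sub>F n in sequentially. indicator (C n) x *\<^sub>R f x = indicator \<Omega> x *\<^sub>R f x"
        unfolding eventually_sequentially by blast
      then show ?thesis by (rule tendsto_eventually)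
    next
      case False
      then have "(\<lambda>n. indicator (C n) x *\<^sub>R f x) = (\<lambda>n. indicator \<Omega> x *\<^sub>R f x)"
        using C(2) by (auto simp: indicator_def fun_eq_iff)
      then show ?thesis by simp
    qed
  qed
  then show ?thesis
    using assms(1) by (subst borel_measurable_restrict_space_iff) (auto intro: lmeasurable_open)
qed

text \<open>Makes the two integrals in the definition of a weak gradient genuine, so that they are additive in the
function and in its gradient.\<close>

lemma integrable_mult_compactly_supported:
  fixes f :: "real^'n \<Rightarrow> 'b::euclidean_space"
  assumes "open \<Omega>" "locally_integrable_on f \<Omega>" "compact K" "K \<subseteq> \<Omega>"
    and "continuous_on UNIV \<psi>" "\<And>x. x \<notin> K \<Longrightarrow> \<psi> x = 0"
  shows "integrable (lebesgue_on \<Omega>) (\<lambda>x. (\<psi> x :: real) *\<^sub>R f x)"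
proof -
  obtain M where M: "\<And>x. x \<in> K \<Longrightarrow> norm (\<psi> x) \<le> M"
    using compact_imp_bounded[OF compact_continuous_image[OF continuous_on_subset[OF assms(5)] assms(3)]]
    by (auto simp: bounded_iff)
  have fK: "integrable lebesgue (\<lambda>x. indicator K x *\<^sub>R f x)"
    using assms(2-4) by (auto simp: locally_integrable_on_def set_integrable_def)
  have psi: "\<psi> \<in> borel_measurable lebesgue"
    using borel_measurable_continuous_onI[OF assms(5)] by (simp add: measurable_completion)
  have eq: "\<psi> x *\<^sub>R (indicator K x *\<^sub>R f x) = indicator \<Omega> x *\<^sub>R (\<psi> x *\<^sub>R f x)" for x
    using assms(4) assms(6)[of x] by (auto simp: indicator_def)
  have "integrable lebesgue (\<lambda>x. \<psi> x *\<^sub>R (indicator K x *\<^sub>R f x))"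
  proof (rule Bochner_Integration.integrable_bound)
    show "integrable lebesgue (\<lambda>x. M * norm (indicator K x *\<^sub>R f x))"
      using fK by (intro integrable_mult_right integrable_norm)
    show "(\<lambda>x. \<psi> x *\<^sub>R (indicator K x *\<^sub>R f x)) \<in> borel_measurable lebesgue"
      by (intro borel_measurable_scaleR psi borel_measurable_integrable fK)
    show "AE x in lebesgue. norm (\<psi> x *\<^sub>R indicator K x *\<^sub>R f x) \<le> norm (M * norm (indicator K x *\<^sub>R f x))"
    proof (intro AE_I2)
      fix x
      show "norm (\<psi> x *\<^sub>R indicator K x *\<^sub>R f x) \<le> norm (M * norm (indicator K x *\<^sub>R f x))"
      proof (cases "x \<in> K")
        case True
        then have "\<bar>\<psi> x\<bar> \<le> \<bar>M\<bar>" using M[OF True] by auto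
        then show ?thesis using True by (simp add: abs_mult mult_right_mono)
      qed simp
    qed
  qed
  then show ?thesis
    unfolding eq using assms(1) by (subst integrable_restrict_space) (auto simp: lmeasurable_open)
qed

text \<open>All that the integration theory uses of a test function: it and its partial derivatives are continuous and
vanish off one compact subset of the domain.\<close>

lemma test_functionE:
  fixes \<phi> :: "real^'n \<Rightarrow> real"
  assumes "test_function \<Omega> \<phi>"
  obtains K where "compact K" "K \<subseteq> \<Omega>" "\<And>x. x \<notin> K \<Longrightarrow> \<phi> x = 0"
    "\<And>x i. x \<notin> K \<Longrightarrow> partial_deriv i \<phi> x = 0"
    "continuous_on UNIV \<phi>" "\<And>i. continuous_on UNIV (partial_deriv i \<phi>)"
proof -
  define K where "K = closure {x. \<phi> x \<noteq> 0}"
  have K: "compact K" "K \<subseteq> \<Omega>" using assms by (simp_all add: test_function_def K_def)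
  have zero: "\<phi> x = 0" if "x \<notin> K" for x
    using that closure_subset[of "{x. \<phi> x \<noteq> 0}"] unfolding K_def by blast
  have pzero: "partial_deriv i \<phi> x = 0" if x: "x \<notin> K" for x i
  proof -
    have "(\<phi> has_derivative (\<lambda>h. 0)) (at x)"
    proof (rule has_derivative_transform_within_open[OF has_derivative_const[of 0]])
      show "open (- K)" using K(1) by (simp add: compact_imp_closed open_Compl)
    qed (use x zero in auto)
    then show ?thesis by (rule partial_deriv_eq)
  qed
  have "C_k 0 \<phi>" "C_k (Suc 0) \<phi>" using assms by (auto simp only: test_function_def)
  then show ?thesis by (intro that[OF K zero pzero]) auto
qed

text \<open>Open boxes form an intersection-stable generator of the Borel sets, so by Dynkin's theorem all integrals of
\<open>f\<close> over Borel sets vanish.\<close>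

lemma AE_zero_if_box_integrals_zero:
  fixes f :: "real^'n \<Rightarrow> real"
  assumes f: "integrable lborel f" and box: "\<And>a b. (LINT x:box a b|lborel. f x) = 0"
  shows "AE x in lborel. f x = 0"
proof (rule sigma_finite_measure.density_zero[OF sigma_finite_lborel f])
  have int: "set_integrable lborel A f" if "A \<in> sets borel" for A
    unfolding set_integrable_def using that f by (intro integrable_mult_indicator) auto
  have total: "(LINT x|lborel. f x) = 0"
  proof (rule LIMSEQ_unique)
    let ?Q = "\<lambda>n. box (\<chi> i. - real n) (\<chi> i. real n) :: (real^'n) set"
    have UN: "(\<Union>n. ?Q n) = UNIV"
    proof (intro equalityI subset_UNIV subsetI UN_iff[THEN iffD2])
      fix x :: "real^'n"
      obtain n :: nat where n: "norm x < real n" using reals_Archimedean2 by blast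
      have "- real n < x $ i \<and> x $ i < real n" for i
        using n component_le_norm_cart[of x i] by linarith
      then show "\<exists>n\<in>UNIV. x \<in> ?Q n" by (auto simp: mem_box_cart)
    qed
    have "incseq ?Q"
    proof (intro incseq_SucI subsetI)
      fix n and x :: "real^'n"
      assume "x \<in> ?Q n"
      then have "- real n < x $ i \<and> x $ i < real n" for i by (simp add: mem_box_cart)
      then have "- real (Suc n) < x $ i \<and> x $ i < real (Suc n)" for i by (smt (verit) of_nat_Suc)
      then show "x \<in> ?Q (Suc n)" by (simp add: mem_box_cart)
    qed
    then have "(\<lambda>n. LINT x:?Q n|lborel. f x) \<longlonglongrightarrow> (LINT x:(\<Union>n. ?Q n)|lborel. f x)"
      by (intro set_integral_cont_up int) (simp_all add: UN)
    then show "(\<lambda>n. LINT x:?Q n|lborel. f x) \<longlonglongrightarrow> (LINT x|lborel. f x)"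
      by (simp add: UN set_lebesgue_integral_def)
    show "(\<lambda>n. LINT x:?Q n|lborel. f x) \<longlonglongrightarrow> 0" by (simp add: box)
  qed
  fix A assume "A \<in> sets (lborel :: (real^'n) measure)"
  then have A: "A \<in> sigma_sets UNIV (range (\<lambda>(a, b). box a b))" by (simp add: borel_eq_box)
  have "Int_stable (range (\<lambda>(a, b). box a b :: (real^'n) set))"
    by (auto simp: Int_stable_def box_Int_box)
  moreover have "range (\<lambda>(a, b). box a b :: (real^'n) set) \<subseteq> Pow UNIV" by simp
  moreover note A
  ultimately show "(LINT x:A|lborel. f x) = 0"
  proof (induction rule: sigma_sets_induct_disjoint)
    case (basic A) then show ?case using box by auto
  next
    case empty then show ?case by (simp add: set_lebesgue_integral_def)
  next
    case (compl A)
    then have A: "A \<in> sets borel" by (simp add: borel_eq_box)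
    have "(LINT x:A \<union> (UNIV - A)|lborel. f x) = (LINT x:A|lborel. f x) + (LINT x:UNIV - A|lborel. f x)"
      using A by (intro set_integral_Un int) auto
    then show ?case using compl.IH total by (simp add: set_lebesgue_integral_def)
  next
    case (union F)
    then have F: "\<And>i. F i \<in> sets borel" by (simp add: borel_eq_box subset_eq)
    have "(LINT x:(\<Union>i. F i)|lborel. f x) = (\<Sum>i. LINT x:F i|lborel. f x)"
      using F union.hyps by (intro lebesgue_integral_countable_add int) (auto simp: disjoint_family_on_def)
    then show ?case using union.IH by simp
  qed
qed

text \<open>A Lebesgue measurable function agrees almost everywhere with a Borel measurable one, to which the generator
argument applies.\<close>

lemma AE_lebesgue_zero_if_box_integrals_zero:
  fixes f :: "real^'n \<Rightarrow> real"
  assumes f: "integrable lebesgue f" and box: "\<And>a b. (LINT x:box a b|lebesgue. f x) = 0"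
  shows "AE x in lebesgue. f x = 0"
proof -
  obtain g where g: "g \<in> borel_measurable lborel" and fg: "AE x in lborel. f x = g x"
    using completion_ex_borel_measurable_real[OF borel_measurable_integrable[OF f]] by blast
  have fg': "AE x in lebesgue. f x = g x" using fg by (rule AE_completion)
  have g': "g \<in> borel_measurable lebesgue" using g by (rule measurable_completion)
  have int: "integrable lborel g"
    using integrable_cong_AE_imp[OF f g'] fg' g by (subst integrable_completion[symmetric]) auto
  have "(LINT x:box a b|lborel. g x) = (LINT x:box a b|lebesgue. f x)" for a b
  proof -
    have "(LINT x:box a b|lborel. g x) = (LINT x:box a b|lebesgue. g x)"
      unfolding set_lebesgue_integral_def using g by (subst integral_completion) auto
    also have "\<dots> = (LINT x:box a b|lebesgue. f x)"
      unfolding set_lebesgue_integral_def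
      using fg' g' borel_measurable_integrable[OF f]
      by (intro integral_cong_AE borel_measurable_scaleR borel_measurable_indicator) auto
    finally show ?thesis .
  qed
  then have "AE x in lborel. g x = 0"
    using AE_zero_if_box_integrals_zero[OF int] box by simp
  then have "AE x in lebesgue. g x = 0" by (rule AE_completion)
  with fg' show ?thesis by eventually_elim simp
qed

text \<open>The fundamental lemma of the calculus of variations. Dominated convergence replaces the smooth bumps by
the indicators of the boxes that they approximate, so \<open>h\<close> has zero integral over each box inside the domain
and vanishes almost everywhere on it; countably many boxes cover the domain.\<close>

lemma AE_zero_if_test_integrals_zero:
  fixes h :: "real^'n \<Rightarrow> real"
  assumes \<Omega>: "open \<Omega>" and h: "locally_integrable_on h \<Omega>"
    and test: "\<And>\<phi>. test_function \<Omega> \<phi> \<Longrightarrow> (LINT x|lebesgue_on \<Omega>. h x * \<phi> x) = 0"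
  shows "AE x in lebesgue_on \<Omega>. h x = 0"
proof -
  have \<Omega>m: "\<Omega> \<in> sets lebesgue" using \<Omega> by simp
  have hc: "integrable lebesgue (\<lambda>x. indicator (cbox a b) x *\<^sub>R h x)" if "cbox a b \<subseteq> \<Omega>" for a b
    using h that by (auto simp: locally_integrable_on_def set_integrable_def)
  have box0: "(LINT x:box a b|lebesgue. h x) = 0" if ab: "cbox a b \<subseteq> \<Omega>" for a b
  proof (rule LIMSEQ_unique)
    let ?s = "\<lambda>n x. box_bump a b n x * (indicator (cbox a b) x *\<^sub>R h x)"
    have bump_m: "box_bump a b n \<in> borel_measurable lebesgue" for n
    proof -
      have "C_k 0 (box_bump a b n)" using test_function_box_bump[OF ab] by (simp only: test_function_def)
      then have "box_bump a b n \<in> borel_measurable borel"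
        by (intro borel_measurable_continuous_onI) simp
      then show ?thesis by (simp add: measurable_completion)
    qed
    have "(\<lambda>n. LINT x|lebesgue. ?s n x) \<longlonglongrightarrow> (LINT x|lebesgue. indicator (box a b) x *\<^sub>R h x)"
    proof (rule integral_dominated_convergence[where w = "\<lambda>x. norm (indicator (cbox a b) x *\<^sub>R h x)"])
      have sub: "indicator (box a b) x *\<^sub>R h x = indicator (box a b) x *\<^sub>R (indicator (cbox a b) x *\<^sub>R h x)" for x
        using box_subset_cbox[of a b] by (auto simp: indicator_def)
      show "(\<lambda>x. indicator (box a b) x *\<^sub>R h x) \<in> borel_measurable lebesgue"
        unfolding sub by (intro borel_measurable_scaleR borel_measurable_indicator borel_measurable_integrable hc[OF ab]) auto
      show "?s n \<in> borel_measurable lebesgue" for n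
        by (intro borel_measurable_times bump_m borel_measurable_integrable hc[OF ab])
      show "integrable lebesgue (\<lambda>x. norm (indicator (cbox a b) x *\<^sub>R h x))"
        by (intro integrable_norm hc[OF ab])
      show "AE x in lebesgue. (\<lambda>n. ?s n x) \<longlonglongrightarrow> indicator (box a b) x *\<^sub>R h x"
      proof (intro AE_I2)
        fix x
        have "(\<lambda>n. ?s n x) \<longlonglongrightarrow> indicator (box a b) x * (indicator (cbox a b) x *\<^sub>R h x)"
          by (intro tendsto_mult box_bump_tendsto_indicator tendsto_const)
        then show "(\<lambda>n. ?s n x) \<longlonglongrightarrow> indicator (box a b) x *\<^sub>R h x"
          unfolding sub[of x] by simp
      qed
      show "AE x in lebesgue. norm (?s n x) \<le> norm (indicator (cbox a b) x *\<^sub>R h x)" for n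
        by (intro AE_I2) (simp add: abs_mult box_bump_bounds mult_left_le_one_le)
    qed
    moreover have "(LINT x|lebesgue. ?s n x) = 0" for n
    proof -
      have "?s n = (\<lambda>x. indicator \<Omega> x *\<^sub>R (h x * box_bump a b n x))"
        using ab box_bump_outside[of _ a b n] box_subset_cbox[of a b]
        by (auto simp: indicator_def fun_eq_iff)
      then have "(LINT x|lebesgue. ?s n x) = (LINT x|lebesgue_on \<Omega>. h x * box_bump a b n x)"
        using \<Omega>m by (subst integral_restrict_space) auto
      then show ?thesis using test[OF test_function_box_bump[OF ab]] by simp
    qed
    ultimately show "(\<lambda>n. 0 :: real) \<longlonglongrightarrow> (LINT x:box a b|lebesgue. h x)"
      by (simp add: set_lebesgue_integral_def)
  qed simp
  \<comment> \<open>Sub-boxes of a closed box inside the domain again have their closures inside it, so the previous fact applies to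
    all of them; the boundary of the box is a null set.\<close>
  have AEc: "AE x in lebesgue. x \<in> cbox a b \<longrightarrow> h x = 0" if ab: "cbox a b \<subseteq> \<Omega>" for a b
  proof -
    have "AE x in lebesgue. indicator (box a b) x * h x = 0"
    proof (rule AE_lebesgue_zero_if_box_integrals_zero)
      have "integrable lebesgue (\<lambda>x. indicator (box a b) x *\<^sub>R (indicator (cbox a b) x *\<^sub>R h x))"
        by (intro integrable_mult_indicator hc[OF ab]) auto
      moreover have "(\<lambda>x. indicator (box a b) x *\<^sub>R (indicator (cbox a b) x *\<^sub>R h x)) =
          (\<lambda>x. indicator (box a b) x * h x)"
        using box_subset_cbox[of a b] by (auto simp: indicator_def fun_eq_iff)
      ultimately show "integrable lebesgue (\<lambda>x. indicator (box a b) x * h x)" by simp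
      fix c d
      obtain e f where ef: "box c d \<inter> box a b = box e f" by (auto simp: box_Int_box)
      have "(LINT x:box e f|lebesgue. h x) = 0"
      proof (cases "box e f = {}")
        case False
        have "closure (box e f) \<subseteq> cbox a b"
          using ef box_subset_cbox[of a b] by (intro closure_minimal) auto
        then show ?thesis using False ab by (intro box0) auto
      qed (simp add: set_lebesgue_integral_def)
      then show "(LINT x:box c d|lebesgue. indicator (box a b) x * h x) = 0"
        by (simp add: set_lebesgue_integral_def mult.assoc[symmetric] indicator_inter_arith[symmetric] ef)
    qed
    moreover have "AE x in lebesgue. x \<notin> cbox a b - box a b"
      by (rule AE_not_in) (use negligible_frontier_interval[of a b] in \<open>simp add: negligible_iff_null_sets\<close>)
    ultimately show ?thesis by eventually_elim (auto simp: indicator_def split: if_splits)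
  qed
  obtain \<D> where D: "countable \<D>" "\<D> \<subseteq> Pow \<Omega>" "\<And>X. X \<in> \<D> \<Longrightarrow> \<exists>a b. X = cbox a b" "\<Union>\<D> = \<Omega>"
    using open_countable_Union_open_cbox[OF \<Omega>] by metis
  have "AE x in lebesgue. \<forall>X\<in>\<D>. x \<in> X \<longrightarrow> h x = 0"
  proof (subst AE_ball_countable[OF D(1)], intro ballI)
    fix X assume "X \<in> \<D>"
    moreover from D(3)[OF this] obtain a b where "X = cbox a b" by blast
    ultimately show "AE x in lebesgue. x \<in> X \<longrightarrow> h x = 0" using AEc[of a b] D(2) by auto
  qed
  then have "AE x in lebesgue. x \<in> \<Omega> \<longrightarrow> h x = 0"
    by eventually_elim (use D(4) in blast)
  then show ?thesis using \<Omega>m by (subst AE_restrict_space_iff) auto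
qed

lemma locally_integrable_on_lincomb:
  "locally_integrable_on f \<Omega> \<Longrightarrow> locally_integrable_on g \<Omega> \<Longrightarrow>
    locally_integrable_on (\<lambda>x. a *\<^sub>R f x + b *\<^sub>R g x) \<Omega>"
  unfolding locally_integrable_on_def
  by (auto intro!: set_integral_add set_integrable_scaleR_right)

lemma locally_integrable_on_component:
  "locally_integrable_on p \<Omega> \<Longrightarrow> locally_integrable_on (\<lambda>x. p x $ i) \<Omega>"
  unfolding locally_integrable_on_def set_integrable_def
proof (intro allI impI)
  fix K assume "\<forall>K. compact K \<and> K \<subseteq> \<Omega> \<longrightarrow> integrable lebesgue (\<lambda>x. indicator K x *\<^sub>R p x)"
    and "compact K \<and> K \<subseteq> \<Omega>"
  then have "integrable lebesgue (\<lambda>x. indicator K x *\<^sub>R p x)" by blast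
  from integrable_bounded_linear[OF bounded_linear_vec_nth this, of i]
  show "integrable lebesgue (\<lambda>x. indicator K x *\<^sub>R p x $ i)" by simp
qed

lemma is_weak_gradient_unique:
  assumes \<Omega>: "open \<Omega>" and p: "is_weak_gradient \<Omega> u p" and q: "is_weak_gradient \<Omega> u q"
  shows "AE x in lebesgue_on \<Omega>. p x = q x"
proof -
  have "AE x in lebesgue_on \<Omega>. p x $ i - q x $ i = 0" for i
  proof (rule AE_zero_if_test_integrals_zero[OF \<Omega>])
    have loc: "locally_integrable_on (\<lambda>x. p x $ i) \<Omega>" "locally_integrable_on (\<lambda>x. q x $ i) \<Omega>"
      using p q by (auto simp: is_weak_gradient_def intro: locally_integrable_on_component)
    from locally_integrable_on_lincomb[OF this, of 1 "-1"]
    show "locally_integrable_on (\<lambda>x. p x $ i - q x $ i) \<Omega>" by simp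
    fix \<phi> :: "real^'a \<Rightarrow> real" assume \<phi>: "test_function \<Omega> \<phi>"
    obtain K where K: "compact K" "K \<subseteq> \<Omega>" "\<And>x. x \<notin> K \<Longrightarrow> \<phi> x = 0" "continuous_on UNIV \<phi>"
      using test_functionE[OF \<phi>] by metis
    have "integrable (lebesgue_on \<Omega>) (\<lambda>x. p x $ i * \<phi> x)" "integrable (lebesgue_on \<Omega>) (\<lambda>x. q x $ i * \<phi> x)"
      using integrable_mult_compactly_supported[OF \<Omega> loc(1) K(1,2,4,3)]
        integrable_mult_compactly_supported[OF \<Omega> loc(2) K(1,2,4,3)] by (simp_all add: mult.commute)
    then show "(LINT x|lebesgue_on \<Omega>. (p x $ i - q x $ i) * \<phi> x) = 0"
      using p q \<phi> by (simp add: is_weak_gradient_def left_diff_distrib)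
  qed
  then have "AE x in lebesgue_on \<Omega>. \<forall>i. p x $ i - q x $ i = 0" by (simp add: AE_all_countable)
  then show ?thesis by eventually_elim (simp add: vec_eq_iff)
qed

lemma is_weak_gradient_lincomb:
  assumes \<Omega>: "open \<Omega>" and p: "is_weak_gradient \<Omega> u p" and q: "is_weak_gradient \<Omega> v q"
  shows "is_weak_gradient \<Omega> (\<lambda>x. a * u x + b * v x) (\<lambda>x. a *\<^sub>R p x + b *\<^sub>R q x)"
  unfolding is_weak_gradient_def
proof (intro conjI allI impI)
  have loc: "locally_integrable_on u \<Omega>" "locally_integrable_on v \<Omega>"
    "locally_integrable_on p \<Omega>" "locally_integrable_on q \<Omega>"
    using p q by (auto simp: is_weak_gradient_def)
  show "locally_integrable_on (\<lambda>x. a * u x + b * v x) \<Omega>"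
    using locally_integrable_on_lincomb[OF loc(1,2), of a b] by simp
  show "locally_integrable_on (\<lambda>x. a *\<^sub>R p x + b *\<^sub>R q x) \<Omega>"
    by (rule locally_integrable_on_lincomb[OF loc(3,4)])
  fix \<phi> :: "real^'a \<Rightarrow> real" and i assume \<phi>: "test_function \<Omega> \<phi>"
  obtain K where K: "compact K" "K \<subseteq> \<Omega>" "\<And>x. x \<notin> K \<Longrightarrow> \<phi> x = 0" "continuous_on UNIV \<phi>"
      "\<And>x. x \<notin> K \<Longrightarrow> partial_deriv i \<phi> x = 0" "continuous_on UNIV (partial_deriv i \<phi>)"
    using test_functionE[OF \<phi>] by metis
  note comp = locally_integrable_on_component[OF loc(3), of i] locally_integrable_on_component[OF loc(4), of i]
  have "integrable (lebesgue_on \<Omega>) (\<lambda>x. u x * partial_deriv i \<phi> x)"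
      "integrable (lebesgue_on \<Omega>) (\<lambda>x. v x * partial_deriv i \<phi> x)"
      "integrable (lebesgue_on \<Omega>) (\<lambda>x. p x $ i * \<phi> x)" "integrable (lebesgue_on \<Omega>) (\<lambda>x. q x $ i * \<phi> x)"
    using integrable_mult_compactly_supported[OF \<Omega> loc(1) K(1,2,6,5)]
      integrable_mult_compactly_supported[OF \<Omega> loc(2) K(1,2,6,5)]
      integrable_mult_compactly_supported[OF \<Omega> comp(1) K(1,2,4,3)]
      integrable_mult_compactly_supported[OF \<Omega> comp(2) K(1,2,4,3)] by (simp_all add: mult.commute)
  then show "(LINT x|lebesgue_on \<Omega>. (a * u x + b * v x) * partial_deriv i \<phi> x) =
      - (LINT x|lebesgue_on \<Omega>. (a *\<^sub>R p x + b *\<^sub>R q x) $ i * \<phi> x)"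
    using p q \<phi> by (simp add: is_weak_gradient_def distrib_right mult.assoc)
qed

lemma weak_gradient_works:
  "weakly_differentiable \<Omega> u \<Longrightarrow> is_weak_gradient \<Omega> u (weak_gradient \<Omega> u)"
  using someI_ex[of "is_weak_gradient \<Omega> u"]
  by (simp add: weakly_differentiable_def weak_gradient_def)

lemma weak_gradient_AE_eq:
  "open \<Omega> \<Longrightarrow> is_weak_gradient \<Omega> u p \<Longrightarrow> AE x in lebesgue_on \<Omega>. weak_gradient \<Omega> u x = p x"
  using is_weak_gradient_unique weak_gradient_works by (metis weakly_differentiable_def)

section \<open>Limits of rapidly converging sequences\<close>

text \<open>The series of the increments converges absolutely almost everywhere, because the integral of its sum of norms is
finite; that sum, together with the first term, is also the dominating function.\<close>

lemma AE_convergent_dominated_if_summable_L1: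
  fixes f :: "nat \<Rightarrow> 'a \<Rightarrow> 'b::euclidean_space"
  assumes f: "\<And>n. integrable M (f n)"
    and sum: "summable (\<lambda>n. LINT x|M. norm (f (Suc n) x - f n x))"
  obtains g G where "g \<in> borel_measurable M" "integrable M G"
    "AE x in M. (\<lambda>n. f n x) \<longlonglongrightarrow> g x" "AE x in M. \<forall>n. norm (f n x) \<le> G x"
proof -
  define d where "d n x = norm (f (Suc n) x - f n x)" for n x
  have d: "integrable M (d n)" for n unfolding d_def by (intro integrable_norm Bochner_Integration.integrable_diff f)
  have d0: "0 \<le> d n x" for n x by (simp add: d_def)
  have sum': "summable (\<lambda>n. integral\<^sup>L M (d n))" using sum unfolding d_def .
  have dm: "d n \<in> borel_measurable M" for n using d by auto
  have "(\<integral>\<^sup>+x. (\<Sum>n. ennreal (d n x)) \<partial>M) = (\<Sum>n. \<integral>\<^sup>+x. ennreal (d n x) \<partial>M)"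
    using dm by (intro nn_integral_suminf) auto
  also have "\<dots> = (\<Sum>n. ennreal (LINT x|M. d n x))"
    by (intro suminf_cong nn_integral_eq_integral d) (simp add: d0)
  also have "\<dots> \<noteq> top"
    by (intro ennreal_suminf_neq_top sum' Bochner_Integration.integral_nonneg d0)
  finally have "AE x in M. (\<Sum>n. ennreal (d n x)) \<noteq> \<infinity>"
    using dm by (intro nn_integral_PInf_AE) auto
  then have AEs: "AE x in M. summable (\<lambda>n. d n x)"
    by eventually_elim (auto intro: summable_suminf_not_top d0)
  have S: "integrable M (\<lambda>x. \<Sum>n. d n x)"
    using AEs sum' by (intro integrable_suminf d) (simp_all add: d0)
  have tele: "f n x = f 0 x + (\<Sum>i<n. f (Suc i) x - f i x)" for n x
    using sum_lessThan_telescope[of "\<lambda>n. f n x" n] by simp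
  show thesis
  proof
    show "(\<lambda>x. lim (\<lambda>n. f n x)) \<in> borel_measurable M"
      using f by (intro borel_measurable_lim_metric) auto
    show "integrable M (\<lambda>x. norm (f 0 x) + (\<Sum>n. d n x))"
      by (intro Bochner_Integration.integrable_add integrable_norm f S)
    show "AE x in M. (\<lambda>n. f n x) \<longlonglongrightarrow> lim (\<lambda>n. f n x)"
      using AEs
    proof eventually_elim
      case (elim x)
      then have "summable (\<lambda>i. f (Suc i) x - f i x)"
        unfolding d_def by (rule summable_norm_cancel)
      then have "(\<lambda>n. f 0 x + (\<Sum>i<n. f (Suc i) x - f i x)) \<longlonglongrightarrow> f 0 x + (\<Sum>i. f (Suc i) x - f i x)"
        by (intro tendsto_add tendsto_const summable_LIMSEQ)
      then have "convergent (\<lambda>n. f n x)" unfolding tele[symmetric] by (rule convergentI)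
      then show ?case by (simp add: convergent_LIMSEQ_iff)
    qed
    show "AE x in M. \<forall>n. norm (f n x) \<le> norm (f 0 x) + (\<Sum>n. d n x)"
      using AEs
    proof (eventually_elim, intro allI, goal_cases)
      case (1 x n)
      have "norm (f n x) \<le> norm (f 0 x) + norm (\<Sum>i<n. f (Suc i) x - f i x)"
        by (subst tele[of n x]) (rule norm_triangle_ineq)
      also have "norm (\<Sum>i<n. f (Suc i) x - f i x) \<le> (\<Sum>i<n. d i x)"
        unfolding d_def by (rule norm_sum)
      also have "\<dots> \<le> (\<Sum>i. d i x)"
        using 1 by (intro sum_le_suminf) (auto simp: d0)
      finally show ?case by simp
    qed
  qed
qed

text \<open>The lemma of Fatou in the form needed for energies. The bound is only required from index \<open>n\<close> on, because
the Cauchy estimate for the distance to the \<open>n\<close>-th term holds only for later terms.\<close>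

lemma fatou_bound:
  fixes h :: "nat \<Rightarrow> 'a \<Rightarrow> real"
  assumes h: "\<And>k. integrable M (h k)" "\<And>k. AE x in M. 0 \<le> h k x"
    and g: "g \<in> borel_measurable M" and lim: "AE x in M. (\<lambda>k. h k x) \<longlonglongrightarrow> g x"
    and le: "\<And>k. n \<le> k \<Longrightarrow> (LINT x|M. h k x) \<le> C"
  shows "integrable M g" "(LINT x|M. g x) \<le> C"
proof -
  have C: "0 \<le> C" using integral_nonneg_AE[OF h(2)[of n]] le[of n] by simp
  have hn: "AE x in M. \<forall>k. 0 \<le> h k x" using h(2) by (simp add: AE_all_countable)
  have g0: "AE x in M. 0 \<le> g x"
    using hn lim by eventually_elim (auto intro: LIMSEQ_le_const)
  have "(\<integral>\<^sup>+x. ennreal (g x) \<partial>M) = (\<integral>\<^sup>+x. liminf (\<lambda>k. ennreal (h k x)) \<partial>M)"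
  proof (rule nn_integral_cong_AE)
    show "AE x in M. ennreal (g x) = liminf (\<lambda>k. ennreal (h k x))"
      using lim by eventually_elim (auto intro!: lim_imp_Liminf[symmetric] tendsto_ennrealI)
  qed
  also have "\<dots> \<le> liminf (\<lambda>k. \<integral>\<^sup>+x. ennreal (h k x) \<partial>M)"
    using h(1) by (intro nn_integral_liminf) auto
  also have "\<dots> \<le> ennreal C"
  proof (rule Liminf_le)
    show "\<forall>\<^sub>F k in sequentially. (\<integral>\<^sup>+x. ennreal (h k x) \<partial>M) \<le> ennreal C"
      using eventually_ge_at_top[of n]
    proof eventually_elim
      case (elim k)
      then show ?case using nn_integral_eq_integral[OF h(1,2)] le by (simp add: ennreal_leI)
    qed
  qed simp
  finally have *: "(\<integral>\<^sup>+x. ennreal (g x) \<partial>M) \<le> ennreal C" .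
  show i: "integrable M g"
    by (rule integrableI_nonneg[OF g g0]) (use * in \<open>auto intro: le_less_trans\<close>)
  show "(LINT x|M. g x) \<le> C"
    using * nn_integral_eq_integral[OF i g0] C by simp
qed

text \<open>The arithmetic--geometric mean inequality with weight \<open>c\<close>: on a set of finite measure it bounds the
\<open>L\<^sup>1\<close> norm by the square of the \<open>L\<^sup>2\<close> norm, and the choice of \<open>c\<close> near the
\<open>L\<^sup>2\<close> norm makes the bound linear.\<close>

lemma norm_le_weighted_square: "0 < c \<Longrightarrow> norm z \<le> (c + (norm z)\<^sup>2 / c) / 2" for z :: "'a::real_normed_vector" and c :: real
  using sum_squares_bound[of "norm z" c] by (simp add: field_simps power2_eq_square)

lemma locally_integrable_on_if_integrable:
  fixes f :: "real^'n \<Rightarrow> 'b::euclidean_space"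
  assumes "open \<Omega>" "integrable (lebesgue_on \<Omega>) f"
  shows "locally_integrable_on f \<Omega>"
  unfolding locally_integrable_on_def set_integrable_def
proof (intro allI impI)
  fix K assume K: "compact K \<and> K \<subseteq> \<Omega>"
  have "integrable lebesgue (\<lambda>x. indicator \<Omega> x *\<^sub>R f x)"
    using assms by (subst (asm) integrable_restrict_space) auto
  moreover have "K \<in> sets lebesgue" using K by (simp add: lmeasurable_compact fmeasurableD)
  ultimately have "integrable lebesgue (\<lambda>x. indicator K x *\<^sub>R (indicator \<Omega> x *\<^sub>R f x))"
    by (rule integrable_mult_indicator[rotated])
  moreover have "(\<lambda>x. indicator K x *\<^sub>R (indicator \<Omega> x *\<^sub>R f x)) = (\<lambda>x. indicator K x *\<^sub>R f x)"
    using K by (auto simp: indicator_def fun_eq_iff)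
  ultimately show "integrable lebesgue (\<lambda>x. indicator K x *\<^sub>R f x)" by simp
qed

text \<open>Testing against a fixed function is continuous under dominated almost everywhere convergence.\<close>

lemma is_weak_gradient_limit:
  fixes u :: "nat \<Rightarrow> real^'n \<Rightarrow> real"
  assumes \<Omega>: "open \<Omega>" and up: "\<And>n. is_weak_gradient \<Omega> (u n) (p n)"
    and v: "v \<in> borel_measurable (lebesgue_on \<Omega>)" "AE x in lebesgue_on \<Omega>. (\<lambda>n. u n x) \<longlonglongrightarrow> v x"
    and G: "integrable (lebesgue_on \<Omega>) G" "AE x in lebesgue_on \<Omega>. \<forall>n. norm (u n x) \<le> G x"
    and q: "q \<in> borel_measurable (lebesgue_on \<Omega>)" "AE x in lebesgue_on \<Omega>. (\<lambda>n. p n x) \<longlonglongrightarrow> q x"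
    and H: "integrable (lebesgue_on \<Omega>) H" "AE x in lebesgue_on \<Omega>. \<forall>n. norm (p n x) \<le> H x"
  shows "is_weak_gradient \<Omega> v q"
  unfolding is_weak_gradient_def
proof (intro conjI allI impI)
  let ?M = "lebesgue_on \<Omega>"
  have uG: "AE x in ?M. norm (u n x) \<le> G x" and pH: "AE x in ?M. norm (p n x) \<le> H x" for n
    using G(2) H(2) by (auto simp: AE_all_countable)
  have um: "u n \<in> borel_measurable ?M" and pm: "p n \<in> borel_measurable ?M" for n
    using up[of n] \<Omega> by (auto simp: is_weak_gradient_def intro: locally_integrable_on_imp_measurable)
  show "locally_integrable_on v \<Omega>"
    by (rule locally_integrable_on_if_integrable[OF \<Omega>
          integrable_dominated_convergence[OF v(1) um G(1) v(2) uG]])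
  show "locally_integrable_on q \<Omega>"
    by (rule locally_integrable_on_if_integrable[OF \<Omega>
          integrable_dominated_convergence[OF q(1) pm H(1) q(2) pH]])
  have limit: "(\<lambda>n. LINT x|?M. f n x * \<psi> x) \<longlonglongrightarrow> (LINT x|?M. g x * \<psi> x)"
    if f: "\<And>n. f n \<in> borel_measurable ?M" "\<And>n. AE x in ?M. \<bar>f n x\<bar> \<le> F x" "integrable ?M F"
      and g: "g \<in> borel_measurable ?M" "AE x in ?M. (\<lambda>n. f n x) \<longlonglongrightarrow> g x"
      and K: "compact K" "\<And>x. x \<notin> K \<Longrightarrow> \<psi> x = 0" "continuous_on UNIV \<psi>"
    for f :: "nat \<Rightarrow> real^'n \<Rightarrow> real" and g F \<psi> :: "real^'n \<Rightarrow> real" and K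
  proof -
    have "\<psi> \<in> borel_measurable lebesgue"
      using borel_measurable_continuous_onI[OF K(3)] by (simp add: measurable_completion)
    then have \<psi>: "\<psi> \<in> borel_measurable ?M" by (rule measurable_restrict_space1)
    obtain B where B: "\<And>x. x \<in> K \<Longrightarrow> norm (\<psi> x) \<le> B"
      using compact_imp_bounded[OF compact_continuous_image[OF continuous_on_subset[OF K(3)] K(1)]]
      by (auto simp: bounded_iff)
    have B': "\<bar>\<psi> x\<bar> \<le> \<bar>B\<bar>" for x using B[of x] K(2)[of x] by (cases "x \<in> K") auto
    show ?thesis
    proof (rule integral_dominated_convergence[where w = "\<lambda>x. F x * \<bar>B\<bar>"])
      show "(\<lambda>x. g x * \<psi> x) \<in> borel_measurable ?M" "\<And>n. (\<lambda>x. f n x * \<psi> x) \<in> borel_measurable ?M"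
        using f g \<psi> by auto
      show "integrable ?M (\<lambda>x. F x * \<bar>B\<bar>)" using f by simp
      show "AE x in ?M. (\<lambda>n. f n x * \<psi> x) \<longlonglongrightarrow> g x * \<psi> x"
        using g(2) by eventually_elim (intro tendsto_mult tendsto_const)
      show "AE x in ?M. norm (f n x * \<psi> x) \<le> F x * \<bar>B\<bar>" for n
        using f(2)[of n] by eventually_elim (auto simp: abs_mult intro!: mult_mono B')
    qed
  qed
  fix \<phi> :: "real^'n \<Rightarrow> real" and i assume \<phi>: "test_function \<Omega> \<phi>"
  obtain K where K: "compact K" "K \<subseteq> \<Omega>" "\<And>x. x \<notin> K \<Longrightarrow> \<phi> x = 0" "continuous_on UNIV \<phi>"
      "\<And>x. x \<notin> K \<Longrightarrow> partial_deriv i \<phi> x = 0" "continuous_on UNIV (partial_deriv i \<phi>)"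
    using test_functionE[OF \<phi>] by metis
  have uv: "(\<lambda>n. LINT x|?M. u n x * partial_deriv i \<phi> x) \<longlonglongrightarrow> (LINT x|?M. v x * partial_deriv i \<phi> x)"
    using uG by (intro limit[OF um _ G(1) v K(1,5,6)]) auto
  have pq: "(\<lambda>n. LINT x|?M. p n x $ i * \<phi> x) \<longlonglongrightarrow> (LINT x|?M. q x $ i * \<phi> x)"
  proof (rule limit[OF _ _ H(1) _ _ K(1,3,4)])
    have nth: "(\<lambda>y :: real^'n. y $ i) \<in> borel_measurable borel"
      by (intro borel_measurable_continuous_onI continuous_intros)
    show "(\<lambda>x. p n x $ i) \<in> borel_measurable ?M" "(\<lambda>x. q x $ i) \<in> borel_measurable ?M" for n
      using measurable_compose[OF pm nth] measurable_compose[OF q(1) nth] by auto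
    show "AE x in ?M. \<bar>p n x $ i\<bar> \<le> H x" for n
      using pH[of n] by eventually_elim (rule order_trans[OF component_le_norm_cart])
    show "AE x in ?M. (\<lambda>n. p n x $ i) \<longlonglongrightarrow> q x $ i"
      using q(2) by eventually_elim (rule tendsto_vec_nth)
  qed
  have "(LINT x|?M. u n x * partial_deriv i \<phi> x) = - (LINT x|?M. p n x $ i * \<phi> x)" for n
    using up[of n] \<phi> by (simp add: is_weak_gradient_def)
  with tendsto_minus[OF pq]
  have "(\<lambda>n. LINT x|?M. u n x * partial_deriv i \<phi> x) \<longlonglongrightarrow> - (LINT x|?M. q x $ i * \<phi> x)"
    by simp
  with uv show "(LINT x|?M. v x * partial_deriv i \<phi> x) = - (LINT x|?M. q x $ i * \<phi> x)"
    by (rule LIMSEQ_unique)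
qed

section \<open>The energy space\<close>

locale weighted_domain =
  fixes \<Omega> :: "(real^'n) set" and D \<mu> :: "real^'n \<Rightarrow> real" and D0 \<mu>0 :: real
  assumes open_domain: "open \<Omega>" and bounded_domain: "bounded \<Omega>"
    and D_measurable: "D \<in> borel_measurable (lebesgue_on \<Omega>)"
    and D0_pos: "0 < D0" and D_ge: "AE x in lebesgue_on \<Omega>. D0 \<le> D x"
    and \<mu>_measurable: "\<mu> \<in> borel_measurable (lebesgue_on \<Omega>)"
    and \<mu>0_pos: "0 < \<mu>0" and \<mu>_ge: "AE x in lebesgue_on \<Omega>. \<mu>0 \<le> \<mu> x"
begin

abbreviation "M \<equiv> lebesgue_on \<Omega>"
abbreviation "V \<equiv> V_space \<Omega> D \<mu>"
abbreviation "E \<equiv> energy_form \<Omega> D \<mu>"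

text \<open>The gradients \<open>p\<close> and \<open>q\<close> are explicit arguments: a sum or a limit comes with its own gradient, which
agrees with the chosen one only almost everywhere.\<close>

definition energy_density where
  "energy_density u p v q x = D x * (p x \<bullet> q x) + \<mu> x * u x * v x"

lemma weak_gradient_measurable:
  assumes "is_weak_gradient \<Omega> u p"
  shows "u \<in> borel_measurable M" "p \<in> borel_measurable M"
  using assms open_domain
  by (auto simp: is_weak_gradient_def intro: locally_integrable_on_imp_measurable)

lemma energy_density_measurable:
  assumes "is_weak_gradient \<Omega> u p" "is_weak_gradient \<Omega> v q"
  shows "energy_density u p v q \<in> borel_measurable M"
  unfolding energy_density_def[abs_def]
  using weak_gradient_measurable[OF assms(1)] weak_gradient_measurable[OF assms(2)]
    D_measurable \<mu>_measurable by (intro borel_measurable_add borel_measurable_times borel_measurable_inner)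

lemma energy_density_ge:
  "AE x in M. D0 * (norm (p x))\<^sup>2 + \<mu>0 * (u x)\<^sup>2 \<le> energy_density u p u p x"
  using D_ge \<mu>_ge
proof eventually_elim
  case (elim x)
  have "D0 * (norm (p x))\<^sup>2 \<le> D x * (norm (p x))\<^sup>2" "\<mu>0 * (u x)\<^sup>2 \<le> \<mu> x * (u x)\<^sup>2"
    using elim by (auto intro: mult_right_mono)
  then show ?case by (simp add: energy_density_def power2_norm_eq_inner) (simp add: power2_eq_square mult.assoc)
qed

lemma energy_density_nonneg: "AE x in M. 0 \<le> energy_density u p u p x"
  using energy_density_ge[of p u]
proof eventually_elim
  case (elim x)
  have "0 \<le> D0 * (norm (p x))\<^sup>2 + \<mu>0 * (u x)\<^sup>2" using D0_pos \<mu>0_pos by simp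
  with elim show ?case by linarith
qed

lemma energy_density_AE_cong:
  assumes "is_weak_gradient \<Omega> u p" "is_weak_gradient \<Omega> v q"
  shows "AE x in M. energy_density u (weak_gradient \<Omega> u) v (weak_gradient \<Omega> v) x = energy_density u p v q x"
  using weak_gradient_AE_eq[OF open_domain assms(1)] weak_gradient_AE_eq[OF open_domain assms(2)]
  by eventually_elim (simp add: energy_density_def)

lemma weak_gradient_exists:
  "is_weak_gradient \<Omega> u p \<Longrightarrow> is_weak_gradient \<Omega> u (weak_gradient \<Omega> u)"
  using weak_gradient_works weakly_differentiable_def by blast

lemma V_iff:
  assumes "is_weak_gradient \<Omega> u p"
  shows "u \<in> V \<longleftrightarrow> integrable M (energy_density u p u p)"
proof -
  note w = weak_gradient_exists[OF assms]
  have "u \<in> V \<longleftrightarrow> integrable M (energy_density u (weak_gradient \<Omega> u) u (weak_gradient \<Omega> u))"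
    using assms by (auto simp: V_space_def energy_density_def[abs_def] weakly_differentiable_def)
  also have "\<dots> \<longleftrightarrow> integrable M (energy_density u p u p)"
    by (intro integrable_cong_AE energy_density_measurable w assms energy_density_AE_cong)
  finally show ?thesis .
qed

lemma energy_eq:
  assumes "is_weak_gradient \<Omega> u p" "is_weak_gradient \<Omega> v q"
  shows "E u v = (LINT x|M. energy_density u p v q x)"
proof -
  have "E u v = (LINT x|M. energy_density u (weak_gradient \<Omega> u) v (weak_gradient \<Omega> v) x)"
    by (simp add: energy_form_def energy_density_def)
  also have "\<dots> = (LINT x|M. energy_density u p v q x)"
    using assms by (intro integral_cong_AE energy_density_measurable energy_density_AE_cong weak_gradient_exists)
  finally show ?thesis .
qed

lemma V_gradient: "u \<in> V \<Longrightarrow> is_weak_gradient \<Omega> u (weak_gradient \<Omega> u)"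
  by (simp add: V_space_def weak_gradient_works)

text \<open>Young's inequality, with the nonnegative weights as factors, bounds the mixed density by the sum of the
two pure ones.\<close>

lemma energy_density_integrable:
  assumes u: "is_weak_gradient \<Omega> u p" "u \<in> V" and v: "is_weak_gradient \<Omega> v q" "v \<in> V"
  shows "integrable M (energy_density u p v q)"
proof (rule Bochner_Integration.integrable_bound)
  show "integrable M (\<lambda>x. energy_density u p u p x + energy_density v q v q x)"
    using u v by (intro Bochner_Integration.integrable_add) (simp_all add: V_iff[symmetric])
  show "energy_density u p v q \<in> borel_measurable M" by (rule energy_density_measurable[OF u(1) v(1)])
  show "AE x in M. norm (energy_density u p v q x) \<le> norm (energy_density u p u p x + energy_density v q v q x)"
    using D_ge \<mu>_ge
  proof eventually_elim
    case (elim x)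
    have pos: "0 \<le> D x" "0 \<le> \<mu> x" using elim D0_pos \<mu>0_pos by auto
    have "2 * \<bar>p x \<bullet> q x\<bar> \<le> 2 * (norm (p x) * norm (q x))"
      using Cauchy_Schwarz_ineq2[of "p x" "q x"] by simp
    also have "\<dots> \<le> p x \<bullet> p x + q x \<bullet> q x"
      using sum_squares_bound[of "norm (p x)" "norm (q x)"] by (simp add: power2_norm_eq_inner)
    finally have "\<bar>p x \<bullet> q x\<bar> \<le> p x \<bullet> p x + q x \<bullet> q x" by simp
    moreover have "\<bar>u x * v x\<bar> \<le> u x * u x + v x * v x"
      using sum_squares_bound[of "\<bar>u x\<bar>" "\<bar>v x\<bar>"] zero_le_square[of "u x"] zero_le_square[of "v x"]
      unfolding abs_mult power2_eq_square abs_mult_self_eq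
      using mult_nonneg_nonneg[of "\<bar>u x\<bar>" "\<bar>v x\<bar>"] by linarith
    ultimately have "D x * \<bar>p x \<bullet> q x\<bar> + \<mu> x * \<bar>u x * v x\<bar> \<le>
        D x * (p x \<bullet> p x + q x \<bullet> q x) + \<mu> x * (u x * u x + v x * v x)"
      using pos by (intro add_mono mult_left_mono)
    moreover have "\<bar>energy_density u p v q x\<bar> \<le> D x * \<bar>p x \<bullet> q x\<bar> + \<mu> x * \<bar>u x * v x\<bar>"
      unfolding energy_density_def using pos
      by (intro order_trans[OF abs_triangle_ineq]) (simp add: abs_mult mult.assoc)
    ultimately show ?case by (simp add: energy_density_def algebra_simps)
  qed
qed

lemma energy_density_lincomb_left:
  "energy_density (\<lambda>x. a * u x + b * v x) (\<lambda>x. a *\<^sub>R p x + b *\<^sub>R q x) w r x =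
     a * energy_density u p w r x + b * energy_density v q w r x"
  by (simp add: energy_density_def inner_add_left algebra_simps)

lemma energy_density_sym: "energy_density u p v q = energy_density v q u p"
  by (simp add: energy_density_def fun_eq_iff inner_commute mult.commute mult.left_commute)

lemma zero_in_V: "(\<lambda>x. 0) \<in> V"
proof -
  have "is_weak_gradient \<Omega> (\<lambda>x. 0) (\<lambda>x. 0)"
    by (simp add: is_weak_gradient_def locally_integrable_on_def set_integrable_def)
  then show ?thesis by (simp add: V_iff energy_density_def[abs_def])
qed

text \<open>Linearity of the form is linearity of the weak gradient up to null sets; positivity comes from the weights.\<close>

sublocale V: semi_inner_space V E
proof
  show "V \<noteq> {}" using zero_in_V by auto
next
  fix u v a b assume uv: "u \<in> V" "v \<in> V"
  let ?p = "weak_gradient \<Omega> u" and ?q = "weak_gradient \<Omega> v"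
  note g = V_gradient[OF uv(1)] V_gradient[OF uv(2)]
  have lc: "is_weak_gradient \<Omega> (\<lambda>x. a * u x + b * v x) (\<lambda>x. a *\<^sub>R ?p x + b *\<^sub>R ?q x)"
    by (rule is_weak_gradient_lincomb[OF open_domain g])
  have "energy_density (\<lambda>x. a * u x + b * v x) (\<lambda>x. a *\<^sub>R ?p x + b *\<^sub>R ?q x)
      (\<lambda>x. a * u x + b * v x) (\<lambda>x. a *\<^sub>R ?p x + b *\<^sub>R ?q x) =
    (\<lambda>x. a * (a * energy_density u ?p u ?p x + b * energy_density v ?q u ?p x)
      + b * (a * energy_density u ?p v ?q x + b * energy_density v ?q v ?q x))"
    by (rule ext, subst energy_density_lincomb_left,
        subst (1 2) energy_density_sym, simp only: energy_density_lincomb_left)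
  moreover have "integrable M \<dots>"
    by (intro Bochner_Integration.integrable_add integrable_mult_right energy_density_integrable uv g)
  ultimately show "(\<lambda>x. a * u x + b * v x) \<in> V"
    unfolding V_iff[OF lc] by simp
next
  fix u v assume "u \<in> V" "v \<in> V"
  then show "E u v = E v u"
    by (simp add: energy_eq[OF V_gradient V_gradient] energy_density_sym[of u])
next
  fix u v w a b assume V: "u \<in> V" "v \<in> V" "w \<in> V"
  note g = V_gradient[OF V(1)] V_gradient[OF V(2)] V_gradient[OF V(3)]
  show "E (\<lambda>x. a * u x + b * v x) w = a * E u w + b * E v w"
    unfolding energy_eq[OF is_weak_gradient_lincomb[OF open_domain g(1,2)] g(3)]
      energy_eq[OF g(1,3)] energy_eq[OF g(2,3)] energy_density_lincomb_left
    using energy_density_integrable[OF g(1) V(1) g(3) V(3)] energy_density_integrable[OF g(2) V(2) g(3) V(3)] by simp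
next
  fix v assume "v \<in> V"
  then show "0 \<le> E v v"
    by (simp add: energy_eq[OF V_gradient V_gradient] integral_nonneg_AE energy_density_nonneg)
qed

lemma gradient_diff:
  assumes "is_weak_gradient \<Omega> u p" "is_weak_gradient \<Omega> v q"
  shows "is_weak_gradient \<Omega> (u - v) (\<lambda>x. p x - q x)"
  using is_weak_gradient_lincomb[OF open_domain assms, of 1 "-1"] by (simp add: fun_diff_def)

lemma integrable_const_domain: "integrable M (\<lambda>x. c :: real)"
  by (intro finite_measure.integrable_const finite_measure_lebesgue_on
      lmeasurable_open bounded_domain open_domain)

text \<open>Functions controlled by the energy are integrable since the domain has finite measure. The bound is
proportional to the energy norm, so that increments with geometrically decreasing energy have summable
\<open>L\<^sup>1\<close> norms.\<close>

lemma L1_bound: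
  fixes f :: "real^'n \<Rightarrow> 'b::euclidean_space"
  assumes w: "w \<in> V" "is_weak_gradient \<Omega> w p" and f: "f \<in> borel_measurable M"
    and \<kappa>: "0 < \<kappa>" "AE x in M. \<kappa> * (norm (f x))\<^sup>2 \<le> energy_density w p w p x"
    and c: "0 < c" "E w w \<le> c\<^sup>2"
  shows "integrable M f" "(LINT x|M. norm (f x)) \<le> c * ((measure M (space M) + 1 / \<kappa>) / 2)"
proof -
  let ?b = "\<lambda>x. (c + energy_density w p w p x / (\<kappa> * c)) / 2"
  have e: "integrable M (energy_density w p w p)" using V_iff[OF w(2)] w(1) by simp
  have b: "integrable M ?b"
    by (intro integrable_divide Bochner_Integration.integrable_add integrable_const_domain e)
  have le: "AE x in M. norm (f x) \<le> ?b x"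
    using \<kappa>(2)
  proof eventually_elim
    case (elim x)
    have "(norm (f x))\<^sup>2 / c = \<kappa> * (norm (f x))\<^sup>2 / (\<kappa> * c)" using \<kappa>(1) by simp
    also have "\<dots> \<le> energy_density w p w p x / (\<kappa> * c)"
      using elim \<kappa>(1) c(1) by (intro divide_right_mono) auto
    finally show ?case using norm_le_weighted_square[OF c(1), of "f x"] by simp
  qed
  show i: "integrable M f"
  proof (rule Bochner_Integration.integrable_bound[OF b f])
    show "AE x in M. norm (f x) \<le> norm (?b x)" using le by eventually_elim simp
  qed
  have "(LINT x|M. norm (f x)) \<le> (LINT x|M. ?b x)"
    by (intro integral_mono_AE integrable_norm b le i)
  also have "\<dots> = (c * measure M (space M) + E w w / (\<kappa> * c)) / 2"
    using e integrable_const_domain by (simp add: energy_eq[OF w(2) w(2)])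
  also have "\<dots> \<le> (c * measure M (space M) + c\<^sup>2 / (\<kappa> * c)) / 2"
    using \<kappa>(1) c by (intro divide_right_mono add_left_mono) auto
  also have "\<dots> = c * ((measure M (space M) + 1 / \<kappa>) / 2)"
    using \<kappa>(1) c by (simp add: power2_eq_square field_simps)
  finally show "(LINT x|M. norm (f x)) \<le> c * ((measure M (space M) + 1 / \<kappa>) / 2)" .
qed

lemma energy_density_controls_gradient: "AE x in M. D0 * (norm (p x))\<^sup>2 \<le> energy_density u p u p x"
  using energy_density_ge[of p u]
proof eventually_elim
  case (elim x)
  have "0 \<le> \<mu>0 * (u x)\<^sup>2" using \<mu>0_pos by simp
  with elim show ?case by linarith
qed

lemma energy_density_controls_value: "AE x in M. \<mu>0 * (norm (u x))\<^sup>2 \<le> energy_density u p u p x"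
  using energy_density_ge[of p u]
proof eventually_elim
  case (elim x)
  have "0 \<le> D0 * (norm (p x))\<^sup>2" using D0_pos by simp
  with elim show ?case by simp
qed

text \<open>Functions and gradients converge almost everywhere to some \<open>u\<close> and \<open>q\<close>, dominated by integrable functions;
hence \<open>q\<close> is a weak gradient of \<open>u\<close>. That \<open>u\<close> has finite energy is known only after the lemma of Fatou has
shown it for \<open>v n - u\<close>.\<close>

lemma V_complete:
  assumes v: "\<And>n. v n \<in> V" and cauchy: "\<And>n k. n \<le> k \<Longrightarrow> E (v n - v k) (v n - v k) \<le> (1/4) ^ n"
  shows "\<exists>u\<in>V. (\<lambda>n. E (v n - u) (v n - u)) \<longlonglongrightarrow> 0"
proof -
  define p where "p n = weak_gradient \<Omega> (v n)" for n
  have vp: "is_weak_gradient \<Omega> (v n) (p n)" for n unfolding p_def by (rule V_gradient[OF v])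
  have dp: "is_weak_gradient \<Omega> (v n - v k) (\<lambda>x. p n x - p k x)" for n k
    by (rule gradient_diff[OF vp vp])
  have dV: "v n - v k \<in> V" for n k by (rule V.diff[OF v v])
  have int: "integrable M (v n)" "integrable M (p n)" for n
  proof -
    have c: "0 < sqrt (E (v n) (v n)) + 1" "E (v n) (v n) \<le> (sqrt (E (v n) (v n)) + 1)\<^sup>2"
      using V.nonneg[OF v, of n] by (simp_all add: power2_sum add_nonneg_pos)
    show "integrable M (v n)"
      by (rule L1_bound(1)[OF v vp weak_gradient_measurable(1)[OF vp] \<mu>0_pos energy_density_controls_value c])
    show "integrable M (p n)"
      by (rule L1_bound(1)[OF v vp weak_gradient_measurable(2)[OF vp] D0_pos energy_density_controls_gradient c])
  qed
  have step: "E (v (Suc n) - v n) (v (Suc n) - v n) \<le> ((1/2) ^ n)\<^sup>2" for n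
  proof -
    have "E (v (Suc n) - v n) (v (Suc n) - v n) = E (v n - v (Suc n)) (v n - v (Suc n))"
      by (simp add: V.diff_diag v V.sym[of "v (Suc n)" "v n"])
    also have "\<dots> \<le> (1/4) ^ n" by (rule cauchy) simp
    also have "(1/4 :: real) ^ n = ((1/2) ^ n)\<^sup>2"
      by (simp add: power2_eq_square power_mult_distrib[symmetric])
    finally show ?thesis .
  qed
  have geom: "summable (\<lambda>n. (1/2) ^ n * c)" for c :: real
    by (intro summable_mult2 summable_geometric) simp
  have sum_v: "summable (\<lambda>n. LINT x|M. norm (v (Suc n) x - v n x))"
  proof (rule summable_comparison_test'[OF geom, of 0])
    show "norm (LINT x|M. norm (v (Suc n) x - v n x)) \<le> (1/2) ^ n * ((measure M (space M) + 1 / \<mu>0) / 2)" for n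
      using L1_bound(2)[OF dV dp weak_gradient_measurable(1)[OF dp] \<mu>0_pos energy_density_controls_value _ step, of n]
      by (simp add: fun_diff_def)
  qed
  have sum_p: "summable (\<lambda>n. LINT x|M. norm (p (Suc n) x - p n x))"
  proof (rule summable_comparison_test'[OF geom, of 0])
    show "norm (LINT x|M. norm (p (Suc n) x - p n x)) \<le> (1/2) ^ n * ((measure M (space M) + 1 / D0) / 2)" for n
      using L1_bound(2)[OF dV dp weak_gradient_measurable(2)[OF dp] D0_pos energy_density_controls_gradient _ step, of n]
      by simp
  qed
  obtain u G where u: "u \<in> borel_measurable M" and G: "integrable M G"
    and vu: "AE x in M. (\<lambda>n. v n x) \<longlonglongrightarrow> u x" and vG: "AE x in M. \<forall>n. norm (v n x) \<le> G x"
    by (rule AE_convergent_dominated_if_summable_L1[OF int(1) sum_v])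
  obtain q H where q: "q \<in> borel_measurable M" and H: "integrable M H"
    and pq: "AE x in M. (\<lambda>n. p n x) \<longlonglongrightarrow> q x" and pH: "AE x in M. \<forall>n. norm (p n x) \<le> H x"
    by (rule AE_convergent_dominated_if_summable_L1[OF int(2) sum_p])
  have uq: "is_weak_gradient \<Omega> u q"
    by (rule is_weak_gradient_limit[OF open_domain vp u vu G vG q pq H pH])
  have lim: "v n - u \<in> V \<and> E (v n - u) (v n - u) \<le> (1/4) ^ n" for n
  proof -
    let ?h = "\<lambda>k. energy_density (v n - v k) (\<lambda>x. p n x - p k x) (v n - v k) (\<lambda>x. p n x - p k x)"
    let ?g = "energy_density (v n - u) (\<lambda>x. p n x - q x) (v n - u) (\<lambda>x. p n x - q x)"
    note dg = gradient_diff[OF vp uq, of n]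
    have h: "integrable M (?h k)" for k using dV V_iff[OF dp] by blast
    have conv: "AE x in M. (\<lambda>k. ?h k x) \<longlonglongrightarrow> ?g x"
      using vu pq
      by eventually_elim (auto simp: energy_density_def intro!: tendsto_intros)
    have le: "(LINT x|M. ?h k x) \<le> (1/4) ^ n" if "n \<le> k" for k
      using cauchy[OF that] by (simp add: energy_eq[OF dp dp])
    note fatou = fatou_bound[OF h energy_density_nonneg energy_density_measurable[OF dg dg] conv le]
    show ?thesis
      using fatou by (simp add: V_iff[OF dg] energy_eq[OF dg dg])
  qed
  have "u \<in> V"
  proof -
    have "v 0 - (v 0 - u) \<in> V" using lim[of 0] v[of 0] by (blast intro: V.diff)
    then show ?thesis by (simp add: fun_diff_def)
  qed
  moreover have "(\<lambda>n. E (v n - u) (v n - u)) \<longlonglongrightarrow> 0"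
  proof (rule tendsto_sandwich[OF _ _ tendsto_const])
    show "(\<lambda>n. (1/4) ^ n :: real) \<longlonglongrightarrow> 0" by (rule LIMSEQ_power_zero) simp
    show "\<forall>\<^sub>F n in sequentially. 0 \<le> E (v n - u) (v n - u)"
      by (intro always_eventually allI V.nonneg) (use lim in blast)
    show "\<forall>\<^sub>F n in sequentially. E (v n - u) (v n - u) \<le> (1/4) ^ n"
      using lim by auto
  qed
  ultimately show ?thesis by blast
qed

end

section \<open>Traces, boundary functionals and the two boundary value problems\<close>

text \<open>Elements of the trace space are representatives, so every identity between traces holds almost everywhere only.\<close>

locale traced_domain = weighted_domain \<Omega> D \<mu> D0 \<mu>0
  for \<Omega> :: "(real^'n) set" and D \<mu> D0 \<mu>0 +
  fixes \<gamma> :: "(real^'n \<Rightarrow> real) \<Rightarrow> real^'n \<Rightarrow> real"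
  assumes trace_operator: "is_trace_operator \<Omega> \<gamma>"
begin

abbreviation "S \<equiv> boundary_measure \<Omega>"
abbreviation "V0 \<equiv> V0_space \<Omega> D \<mu> \<gamma>"
abbreviation "T \<equiv> trace_space \<Omega> D \<mu> \<gamma>"
abbreviation "N \<equiv> V_norm \<Omega> D \<mu>"
abbreviation "T_norm \<equiv> trace_norm \<Omega> D \<mu> \<gamma>"
abbreviation "T_dual \<equiv> dual_space \<Omega> D \<mu> \<gamma>"
abbreviation "T_dual_norm \<equiv> dual_norm \<Omega> D \<mu> \<gamma>"

text \<open>The trace operator is given on the unweighted space. Since the weights are bounded below, the
weighted space embeds continuously into it.\<close>

lemma V_subset_H1:
  assumes u: "u \<in> V"
  shows "u \<in> H1_space \<Omega>" "H1_norm \<Omega> u \<le> N u / sqrt (min D0 \<mu>0)"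
proof -
  interpret H1: weighted_domain \<Omega> "\<lambda>_. 1" "\<lambda>_. 1" 1 1
    using open_domain bounded_domain by unfold_locales auto
  let ?\<kappa> = "min D0 \<mu>0" and ?p = "weak_gradient \<Omega> u"
  note up = V_gradient[OF u]
  have \<kappa>: "0 < ?\<kappa>" using D0_pos \<mu>0_pos by simp
  have e: "integrable M (\<lambda>x. energy_density u ?p u ?p x / ?\<kappa>)"
    using u V_iff[OF up] by simp
  have le: "AE x in M. H1.energy_density u ?p u ?p x \<le> energy_density u ?p u ?p x / ?\<kappa>"
    using energy_density_ge[of ?p u]
  proof eventually_elim
    case (elim x)
    have "?\<kappa> * (norm (?p x))\<^sup>2 + ?\<kappa> * (u x)\<^sup>2 \<le> D0 * (norm (?p x))\<^sup>2 + \<mu>0 * (u x)\<^sup>2"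
      by (intro add_mono mult_right_mono) auto
    with elim have "?\<kappa> * ((norm (?p x))\<^sup>2 + (u x)\<^sup>2) \<le> energy_density u ?p u ?p x"
      by (simp add: distrib_left)
    moreover have "H1.energy_density u ?p u ?p x = (norm (?p x))\<^sup>2 + (u x)\<^sup>2"
      by (simp add: H1.energy_density_def power2_norm_eq_inner) (simp add: power2_eq_square)
    ultimately show ?case using \<kappa> by (simp add: pos_le_divide_eq mult.commute)
  qed
  have i: "integrable M (H1.energy_density u ?p u ?p)"
  proof (rule Bochner_Integration.integrable_bound[OF e H1.energy_density_measurable[OF up up]])
    show "AE x in M. norm (H1.energy_density u ?p u ?p x) \<le> norm (energy_density u ?p u ?p x / ?\<kappa>)"
      using le H1.energy_density_nonneg[of u ?p] unfolding real_norm_def by eventually_elim linarith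
  qed
  then show "u \<in> H1_space \<Omega>" using H1.V_iff[OF up] by simp
  have "energy_form \<Omega> (\<lambda>_. 1) (\<lambda>_. 1) u u \<le> E u u / ?\<kappa>"
    unfolding H1.energy_eq[OF up up] energy_eq[OF up up]
    using integral_mono_AE[OF i e le] by simp
  then have "sqrt (energy_form \<Omega> (\<lambda>_. 1) (\<lambda>_. 1) u u) \<le> sqrt (E u u / ?\<kappa>)"
    by (rule real_sqrt_le_mono)
  then show "H1_norm \<Omega> u \<le> N u / sqrt ?\<kappa>"
    by (simp only: V_norm_def real_sqrt_divide)
qed

lemma trace_lincomb:
  "u \<in> V \<Longrightarrow> v \<in> V \<Longrightarrow> AE x in S. \<gamma> (\<lambda>y. a * u y + b * v y) x = a * \<gamma> u x + b * \<gamma> v x"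
  using trace_operator V_subset_H1(1) unfolding is_trace_operator_def by blast

lemma trace_diff: "u \<in> V \<Longrightarrow> v \<in> V \<Longrightarrow> AE x in S. \<gamma> (u - v) x = \<gamma> u x - \<gamma> v x"
  using trace_lincomb[of u v 1 "-1"] by (simp add: fun_diff_def)

lemma trace_zero: "AE x in S. \<gamma> (\<lambda>y. 0) x = 0"
  using trace_lincomb[OF zero_in_V zero_in_V, of 0 0] by simp

lemma trace_bounded:
  obtains C where "\<And>u. u \<in> V \<Longrightarrow> sqrt (LINT x|S. (\<gamma> u x)\<^sup>2) \<le> C * N u"
proof -
  obtain C where C: "\<And>u. u \<in> H1_space \<Omega> \<Longrightarrow> sqrt (LINT x|S. (\<gamma> u x)\<^sup>2) \<le> C * H1_norm \<Omega> u"
    using trace_operator unfolding is_trace_operator_def by blast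
  have "sqrt (LINT x|S. (\<gamma> u x)\<^sup>2) \<le> (\<bar>C\<bar> / sqrt (min D0 \<mu>0)) * N u" if u: "u \<in> V" for u
  proof -
    have "0 \<le> H1_norm \<Omega> u"
      by (simp add: V_norm_def energy_form_def)
    then have "C * H1_norm \<Omega> u \<le> \<bar>C\<bar> * (N u / sqrt (min D0 \<mu>0))"
      using V_subset_H1(2)[OF u] by (intro mult_mono) auto
    then show ?thesis using C[OF V_subset_H1(1)[OF u]] by simp
  qed
  then show thesis by (rule that)
qed

lemma N_nonneg: "u \<in> V \<Longrightarrow> 0 \<le> N u"
  by (simp add: V_norm_def V.nonneg)

text \<open>The trace of \<open>u\<close> equals that of \<open>u - v n\<close> up to sign, and the latter is small in
\<open>L\<^sup>2\<close> of the boundary.\<close>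

lemma V0_closed:
  assumes v: "\<And>n. v n \<in> V0" and u: "u \<in> V" and lim: "(\<lambda>n. E (v n - u) (v n - u)) \<longlonglongrightarrow> 0"
  shows "u \<in> V0"
proof -
  have vV: "v n \<in> V" and v0: "AE x in S. \<gamma> (v n) x = 0" for n using v[of n] by (auto simp: V0_space_def)
  have L2: "\<gamma> u \<in> borel_measurable S" "integrable S (\<lambda>x. (\<gamma> u x)\<^sup>2)"
    if "u \<in> V" for u
    using trace_operator V_subset_H1(1)[OF that] by (auto simp: is_trace_operator_def L2_space_def)
  obtain C where C: "\<And>u. u \<in> V \<Longrightarrow> sqrt (LINT x|S. (\<gamma> u x)\<^sup>2) \<le> C * N u"
    using trace_bounded by metis
  have le: "sqrt (LINT x|S. (\<gamma> u x)\<^sup>2) \<le> C * N (v n - u)" for n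
  proof -
    have d: "v n - u \<in> V" by (rule V.diff[OF vV u])
    have "(LINT x|S. (\<gamma> u x)\<^sup>2) = (LINT x|S. (\<gamma> (v n - u) x)\<^sup>2)"
    proof (rule integral_cong_AE)
      show "AE x in S. (\<gamma> u x)\<^sup>2 = (\<gamma> (v n - u) x)\<^sup>2"
        using trace_diff[OF vV u, of n] v0[of n] by eventually_elim simp
    qed (use L2 u d in auto)
    then show ?thesis using C[OF d] by simp
  qed
  have "(\<lambda>n. C * N (v n - u)) \<longlonglongrightarrow> C * sqrt 0"
    unfolding V_norm_def by (intro tendsto_intros lim)
  then have "sqrt (LINT x|S. (\<gamma> u x)\<^sup>2) \<le> C * sqrt 0"
    using le by (intro LIMSEQ_le_const) auto
  then have "(LINT x|S. (\<gamma> u x)\<^sup>2) \<le> 0" by simp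
  moreover have "0 \<le> (LINT x|S. (\<gamma> u x)\<^sup>2)" by simp
  ultimately have "(LINT x|S. (\<gamma> u x)\<^sup>2) = 0" by simp
  then have "AE x in S. (\<gamma> u x)\<^sup>2 = 0"
    using integral_nonneg_eq_0_iff_AE[OF L2(2)[OF u]] by simp
  then show ?thesis using u by (simp add: V0_space_def)
qed

lemma V0_subset: "u \<in> V0 \<Longrightarrow> u \<in> V"
  by (simp add: V0_space_def)

sublocale V0: semi_inner_space V0 E
proof
  show "V0 \<noteq> {}" using zero_in_V trace_zero by (auto simp: V0_space_def)
next
  fix u v a b assume uv: "u \<in> V0" "v \<in> V0"
  note V = V0_subset[OF uv(1)] V0_subset[OF uv(2)]
  have "AE x in S. \<gamma> u x = 0" "AE x in S. \<gamma> v x = 0" using uv by (auto simp: V0_space_def)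
  with trace_lincomb[OF V, of a b] have "AE x in S. \<gamma> (\<lambda>y. a * u y + b * v y) x = 0"
    by eventually_elim simp
  then show "(\<lambda>x. a * u x + b * v x) \<in> V0" using V.lincomb[OF V] by (simp add: V0_space_def)
qed (simp_all add: V0_subset V.sym V.lincomb_left V.nonneg)

lemma V0_complete:
  assumes v: "\<And>n. v n \<in> V0" and cauchy: "\<And>n k. n \<le> k \<Longrightarrow> E (v n - v k) (v n - v k) \<le> (1/4) ^ n"
  shows "\<exists>u\<in>V0. (\<lambda>n. E (v n - u) (v n - u)) \<longlonglongrightarrow> 0"
proof -
  obtain u where "u \<in> V" "(\<lambda>n. E (v n - u) (v n - u)) \<longlonglongrightarrow> 0"
    using V_complete[OF V0_subset[OF v] cauchy] by blast
  then show ?thesis using V0_closed[where v = v, OF v] by blast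
qed

lemma trace_in_T: "u \<in> V \<Longrightarrow> \<gamma> u \<in> T"
  by (auto simp: trace_space_def)

lemma T_lincomb:
  assumes "w \<in> T" "w' \<in> T"
  shows "(\<lambda>x. a * w x + b * w' x) \<in> T"
proof -
  obtain u v where u: "u \<in> V" "AE x in S. \<gamma> u x = w x" and v: "v \<in> V" "AE x in S. \<gamma> v x = w' x"
    using assms by (auto simp: trace_space_def)
  have "AE x in S. \<gamma> (\<lambda>y. a * u y + b * v y) x = a * w x + b * w' x"
    using trace_lincomb[OF u(1) v(1), of a b] u(2) v(2) by eventually_elim simp
  then show ?thesis using V.lincomb[OF u(1) v(1)] unfolding trace_space_def by blast
qed

lemma T_norm_le:
  assumes "u \<in> V" "AE x in S. \<gamma> u x = g x"
  shows "T_norm g \<le> N u"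
  unfolding trace_norm_def
  by (rule cINF_lower[OF bdd_belowI2[where m = 0]]) (use assms N_nonneg in auto)

lemma T_norm_nonneg:
  assumes "g \<in> T"
  shows "0 \<le> T_norm g"
  unfolding trace_norm_def
  by (rule cINF_greatest) (use assms N_nonneg in \<open>auto simp: trace_space_def\<close>)

text \<open>A null function has trace norm zero, so a functional bounded by the trace norm vanishes on it.\<close>

lemma T_dual_cong:
  assumes F: "F \<in> T_dual" and w: "w \<in> T" "w' \<in> T" and eq: "AE x in S. w x = w' x"
  shows "F w = F w'"
proof -
  let ?z = "\<lambda>x. 1 * w x + (-1) * w' x"
  obtain C where C: "\<And>w. w \<in> T \<Longrightarrow> \<bar>F w\<bar> \<le> C * T_norm w"
    using F unfolding dual_space_def by blast
  have z0: "AE x in S. \<gamma> (\<lambda>y. 0) x = ?z x" using trace_zero eq by eventually_elim simp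
  have z: "?z \<in> T" by (rule T_lincomb[OF w])
  have "N (\<lambda>x. 0) = 0"
    using V.lincomb_left[OF zero_in_V zero_in_V zero_in_V, of 0 0] by (simp add: V_norm_def)
  then have "T_norm ?z = 0"
    using T_norm_le[OF zero_in_V z0] T_norm_nonneg[OF z] by simp
  then have "F ?z = 0" using C[OF z] by simp
  moreover have "F ?z = 1 * F w + (-1) * F w'"
    using F w unfolding dual_space_def by blast
  ultimately show ?thesis by simp
qed

lemma T_dual_linear:
  assumes F: "F \<in> T_dual" and V: "u \<in> V" "v \<in> V"
  shows "F (\<gamma> (\<lambda>x. a * u x + b * v x)) = a * F (\<gamma> u) + b * F (\<gamma> v)"
proof -
  let ?w = "\<lambda>x. a * \<gamma> u x + b * \<gamma> v x"
  note lc = V.lincomb[OF V, of a b]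
  have "?w \<in> T" using lc trace_lincomb[OF V] unfolding trace_space_def by blast
  then have "F (\<gamma> (\<lambda>x. a * u x + b * v x)) = F ?w"
    using T_dual_cong[OF F trace_in_T[OF lc]] trace_lincomb[OF V] by blast
  also have "\<dots> = a * F (\<gamma> u) + b * F (\<gamma> v)"
    using F trace_in_T V unfolding dual_space_def by blast
  finally show ?thesis .
qed

lemma T_dual_bounded:
  assumes F: "F \<in> T_dual"
  obtains C where "0 \<le> C" "\<And>w. w \<in> T \<Longrightarrow> \<bar>F w\<bar> \<le> C * T_norm w" "\<And>v. v \<in> V \<Longrightarrow> \<bar>F (\<gamma> v)\<bar> \<le> C * N v"
proof -
  obtain C where C: "\<And>w. w \<in> T \<Longrightarrow> \<bar>F w\<bar> \<le> C * T_norm w"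
    using F unfolding dual_space_def by blast
  have T: "\<bar>F w\<bar> \<le> \<bar>C\<bar> * T_norm w" if "w \<in> T" for w
    by (rule order_trans[OF C[OF that]]) (simp add: mult_right_mono T_norm_nonneg that)
  have "\<bar>F (\<gamma> v)\<bar> \<le> \<bar>C\<bar> * N v" if v: "v \<in> V" for v
  proof -
    have "T_norm (\<gamma> v) \<le> N v" by (rule T_norm_le[OF v]) simp
    then have "\<bar>C\<bar> * T_norm (\<gamma> v) \<le> \<bar>C\<bar> * N v" by (rule mult_left_mono) simp
    with T[OF trace_in_T[OF v]] show ?thesis by simp
  qed
  with T show thesis by (intro that[of "\<bar>C\<bar>"]) auto
qed

text \<open>The choice in the definition succeeds: \<open>v \<mapsto> F (\<gamma> v)\<close> is a bounded functional on \<open>V\<close>, as the trace norm is at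
most the energy norm.\<close>

lemma neumann_solution:
  assumes F: "F \<in> T_dual"
  shows "neumann_solution \<Omega> D \<mu> \<gamma> F \<in> V"
    "\<And>v. v \<in> V \<Longrightarrow> E (neumann_solution \<Omega> D \<mu> \<gamma> F) v = F (\<gamma> v)"
proof -
  obtain C where C: "\<And>v. v \<in> V \<Longrightarrow> \<bar>F (\<gamma> v)\<bar> \<le> C * N v"
    using T_dual_bounded[OF F] by metis
  have "\<exists>u\<in>V. \<forall>v\<in>V. E u v = F (\<gamma> v)"
    by (rule V.riesz[where L = "\<lambda>v. F (\<gamma> v)" and C = C, OF V_complete])
      (auto simp: T_dual_linear[OF F] C[unfolded V_norm_def])
  then have "\<exists>u. u \<in> V \<and> (\<forall>v\<in>V. E u v = F (\<gamma> v))" by blast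
  from someI_ex[OF this]
  show "neumann_solution \<Omega> D \<mu> \<gamma> F \<in> V"
    "\<And>v. v \<in> V \<Longrightarrow> E (neumann_solution \<Omega> D \<mu> \<gamma> F) v = F (\<gamma> v)"
    unfolding neumann_solution_def by auto
qed

text \<open>Any extension \<open>h\<close> of the boundary values is corrected by its orthogonal projection onto \<open>V\<^sub>0\<close>,
which is the Riesz representative of \<open>E h\<close> on that space.\<close>

lemma dirichlet_solution:
  assumes g: "g \<in> T"
  shows "dirichlet_solution \<Omega> D \<mu> \<gamma> g \<in> V"
    "AE x in S. \<gamma> (dirichlet_solution \<Omega> D \<mu> \<gamma> g) x = g x"
    "\<And>v. v \<in> V0 \<Longrightarrow> E (dirichlet_solution \<Omega> D \<mu> \<gamma> g) v = 0"
proof -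
  obtain h where h: "h \<in> V" "AE x in S. \<gamma> h x = g x" using g by (auto simp: trace_space_def)
  have "\<exists>w\<in>V0. \<forall>v\<in>V0. E w v = E h v"
    by (rule V0.riesz[where L = "E h" and C = "N h", OF V0_complete])
      (auto simp: V_norm_def V.lincomb_right h V0_subset intro: V.cauchy_schwarz)
  then obtain w where w: "w \<in> V0" "\<And>v. v \<in> V0 \<Longrightarrow> E w v = E h v" by blast
  have "AE x in S. \<gamma> w x = 0" using w by (simp add: V0_space_def)
  with trace_diff[OF h(1) V0_subset[OF w(1)]] h(2)
  have "AE x in S. \<gamma> (h - w) x = g x" by eventually_elim simp
  moreover have "E (h - w) v = 0" if "v \<in> V0" for v
    using that w h(1) by (simp add: V.diff_left V0_subset)
  ultimately have "\<exists>u. u \<in> V \<and> (AE x in S. \<gamma> u x = g x) \<and> (\<forall>v\<in>V0. E u v = 0)"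
    using V.diff[OF h(1) V0_subset[OF w(1)]] by blast
  from someI_ex[OF this]
  show "dirichlet_solution \<Omega> D \<mu> \<gamma> g \<in> V"
    "AE x in S. \<gamma> (dirichlet_solution \<Omega> D \<mu> \<gamma> g) x = g x"
    "\<And>v. v \<in> V0 \<Longrightarrow> E (dirichlet_solution \<Omega> D \<mu> \<gamma> g) v = 0"
    unfolding dirichlet_solution_def by auto
qed

text \<open>Pythagoras: another function with the same trace differs from \<open>d\<close> by an element of \<open>V\<^sub>0\<close>, to which \<open>d\<close>
is orthogonal.\<close>

lemma orthogonal_to_V0_minimises_norm:
  assumes d: "d \<in> V" "\<And>v. v \<in> V0 \<Longrightarrow> E d v = 0" and g: "AE x in S. \<gamma> d x = g x"
  shows "N d \<le> T_norm g"
  unfolding trace_norm_def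
proof (rule cINF_greatest)
  show "{u \<in> V. AE x in S. \<gamma> u x = g x} \<noteq> {}" using d(1) g by blast
next
  fix w assume "w \<in> {u \<in> V. AE x in S. \<gamma> u x = g x}"
  then have w: "w \<in> V" "AE x in S. \<gamma> w x = g x" by auto
  have "AE x in S. \<gamma> (w - d) x = 0"
    using trace_diff[OF w(1) d(1)] w(2) g by eventually_elim simp
  then have wd: "w - d \<in> V0" using V.diff[OF w(1) d(1)] by (simp add: V0_space_def)
  have "E d w = E d d" using d(2)[OF wd] by (simp add: V.diff_right d(1) w(1))
  then have "0 \<le> E w w - E d d"
    using V0.nonneg[OF wd] by (simp add: V.diff_diag d(1) w(1) V.sym[of w d])
  then show "N d \<le> N w" by (simp add: V_norm_def)
qed

text \<open>The supremum is taken over a bounded set of quotients. A quotient with vanishing denominator is 0, which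
respects the bound.\<close>

lemma T_dual_norm_quotient:
  assumes F: "F \<in> T_dual" and w: "w \<in> T" "\<not> (AE x in S. w x = 0)"
  shows "F w / T_norm w \<le> T_dual_norm F"
proof -
  obtain C where C: "0 \<le> C" "\<And>w. w \<in> T \<Longrightarrow> \<bar>F w\<bar> \<le> C * T_norm w"
    using T_dual_bounded[OF F] by metis
  show ?thesis
    unfolding dual_norm_def
  proof (rule cSUP_upper[OF _ bdd_aboveI2[where M = C]])
    fix v assume "v \<in> {w \<in> T. \<not> (AE x in S. w x = 0)}"
    then have v: "v \<in> T" by simp
    show "F v / T_norm v \<le> C"
      using C(1) C(2)[OF v] T_norm_nonneg[OF v] by (cases "T_norm v = 0") (auto simp: pos_divide_le_eq)
  qed (use w in auto)
qed

text \<open>One of \<open>F w\<close> and \<open>F (- w)\<close> is nonnegative. Some \<open>w\<close> is needed: the supremum of the empty set of reals has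
no determined value.\<close>

lemma T_dual_norm_nonneg:
  assumes F: "F \<in> T_dual" and w: "w \<in> T" "\<not> (AE x in S. w x = 0)"
  shows "0 \<le> T_dual_norm F"
proof -
  let ?w = "\<lambda>x. (-1) * w x + 0 * w x"
  have w': "?w \<in> T" "\<not> (AE x in S. ?w x = 0)" using T_lincomb[OF w(1) w(1), of "-1" 0] w(2) by auto
  have "F ?w = (-1) * F w + 0 * F w" using F w(1) unfolding dual_space_def by blast
  then have "0 \<le> F w / T_norm w \<or> 0 \<le> F ?w / T_norm ?w"
    using T_norm_nonneg[OF w(1)] T_norm_nonneg[OF w'(1)] by (cases "0 \<le> F w")
      (auto intro: divide_nonpos_nonneg)
  then show ?thesis
    using T_dual_norm_quotient[OF F w] T_dual_norm_quotient[OF F w'] by linarith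
qed

lemma energy_zero_right: "u \<in> V \<Longrightarrow> E u (\<lambda>x. 0) = 0"
  using V.lincomb_right[OF zero_in_V zero_in_V, of u 0 0] by simp

text \<open>Needed where the dual norm does not see the trace of \<open>u\<close>: testing with \<open>u\<close> then gives the same as testing with 0.\<close>

lemma neumann_energy_zero:
  assumes F: "F \<in> T_dual" and u: "u \<in> V" "\<And>v. v \<in> V \<Longrightarrow> E u v = F (\<gamma> v)"
    and null: "AE x in S. \<gamma> u x = 0"
  shows "N u = 0"
proof -
  have "AE x in S. \<gamma> u x = \<gamma> (\<lambda>y. 0) x" using null trace_zero by eventually_elim simp
  then have "F (\<gamma> u) = F (\<gamma> (\<lambda>y. 0))"
    by (rule T_dual_cong[OF F trace_in_T[OF u(1)] trace_in_T[OF zero_in_V]])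
  then have "E u u = E u (\<lambda>y. 0)" using u zero_in_V by simp
  then show ?thesis using energy_zero_right[OF u(1)] by (simp add: V_norm_def)
qed

text \<open>The energy of \<open>u\<close> is \<open>F (\<gamma> u)\<close>, and \<open>u\<close> is itself an admissible extension in the trace norm of \<open>\<gamma> u\<close>.
This proves \<open>N u * N u \<le> T_dual_norm F * N u\<close>; the case \<open>N u = 0\<close> and that of a trace that vanishes, over
which the supremum does not run, are separate.\<close>

lemma neumann_norm_le:
  assumes F: "F \<in> T_dual" and u: "u \<in> V" "\<And>v. v \<in> V \<Longrightarrow> E u v = F (\<gamma> v)"
    and w: "w \<in> T" "\<not> (AE x in S. w x = 0)"
  shows "N u \<le> T_dual_norm F"
proof (cases "N u = 0 \<or> (AE x in S. \<gamma> u x = 0)")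
  case True
  then have "N u = 0" using neumann_energy_zero[OF F u] by blast
  then show ?thesis using T_dual_norm_nonneg[OF F w] by simp
next
  case False
  note Tu = trace_in_T[OF u(1)]
  obtain C where C: "\<And>w. w \<in> T \<Longrightarrow> \<bar>F w\<bar> \<le> C * T_norm w"
    using T_dual_bounded[OF F] by metis
  have pos: "0 < N u" using False N_nonneg[OF u(1)] by simp
  have le: "T_norm (\<gamma> u) \<le> N u" by (rule T_norm_le[OF u(1)]) simp
  have "N u * N u = F (\<gamma> u)"
    using u(2)[OF u(1)] V.nonneg[OF u(1)] by (simp add: V_norm_def)
  also have "\<dots> \<le> T_dual_norm F * T_norm (\<gamma> u)"
    using T_dual_norm_quotient[OF F Tu] False C[OF Tu] T_norm_nonneg[OF Tu]
    by (cases "T_norm (\<gamma> u) = 0") (auto simp: pos_divide_le_eq)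
  also have "\<dots> \<le> T_dual_norm F * N u"
    by (rule mult_left_mono[OF le T_dual_norm_nonneg[OF F w]])
  finally show ?thesis using pos by simp
qed

text \<open>The bound \<open>\<delta>\<close> must be nonnegative for the degenerate case that all traces vanish: then the value of
the dual norm, and with it the hypothesis on the sum of the norms, says nothing.\<close>

lemma stability:
  assumes F: "F \<in> T_dual" and u: "u \<in> V" "\<And>v. v \<in> V \<Longrightarrow> E u v = F (\<gamma> v)"
    and d: "d \<in> V" "\<And>v. v \<in> V0 \<Longrightarrow> E d v = 0" and g: "AE x in S. \<gamma> d x = g x"
    and \<delta>: "0 \<le> \<delta>" "T_norm g + T_dual_norm F \<le> \<delta>"
  shows "N (u - d) \<le> \<delta>"
proof -
  have tri: "N (u - d) \<le> N u + N d"
    unfolding V_norm_def by (rule V.triangle_diff[OF u(1) d(1)])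
  show ?thesis
  proof (cases "\<exists>w\<in>T. \<not> (AE x in S. w x = 0)")
    case True
    then have "N u \<le> T_dual_norm F" using neumann_norm_le[OF F u] by blast
    with tri orthogonal_to_V0_minimises_norm[OF d g] \<delta>(2) show ?thesis by linarith
  next
    case False
    then have null: "AE x in S. \<gamma> v x = 0" if "v \<in> V" for v using trace_in_T[OF that] by blast
    have "d \<in> V0" using d(1) null by (simp add: V0_space_def)
    then have "N d = 0" using d(2) by (simp add: V_norm_def)
    moreover have "N u = 0" by (rule neumann_energy_zero[OF F u null[OF u(1)]])
    ultimately show ?thesis using tri \<delta>(1) by linarith
  qed
qed

lemma T_dual_diff:
  assumes "F \<in> T_dual" "G \<in> T_dual"
  shows "F - G \<in> T_dual"
proof -
  obtain A B where "\<And>w. w \<in> T \<Longrightarrow> \<bar>F w\<bar> \<le> A * T_norm w" "\<And>w. w \<in> T \<Longrightarrow> \<bar>G w\<bar> \<le> B * T_norm w"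
    using assms unfolding dual_space_def by blast
  then have "\<bar>(F - G) w\<bar> \<le> (A + B) * T_norm w" if "w \<in> T" for w
    using abs_triangle_ineq4[of "F w" "G w"] that unfolding distrib_right fun_diff_def by fastforce
  moreover have "(F - G) (\<lambda>x. a * v x + b * w x) = a * (F - G) v + b * (F - G) w"
    if "v \<in> T" "w \<in> T" for v w a b
  proof -
    have "F (\<lambda>x. a * v x + b * w x) = a * F v + b * F w" "G (\<lambda>x. a * v x + b * w x) = a * G v + b * G w"
      using assms that unfolding dual_space_def by blast+
    then show ?thesis by (simp add: algebra_simps)
  qed
  ultimately show ?thesis unfolding dual_space_def by blast
qed

end

theorem proposition5:
  fixes \<Omega> :: "(real^'n) set"
    and D \<mu>\<^sub>a :: "real^'n \<Rightarrow> real" and D\<^sub>0 \<mu>\<^sub>0 \<delta> :: real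
    and \<gamma>\<^sub>0 :: "(real^'n \<Rightarrow> real) \<Rightarrow> real^'n \<Rightarrow> real"
    and g1 g1\<delta> :: "real^'n \<Rightarrow> real"
    and g2 g2\<delta> :: "(real^'n \<Rightarrow> real) \<Rightarrow> real"
    and y y\<delta> :: "real^'n \<Rightarrow> real"
  assumes dim: "CARD('n) = 2 \<or> CARD('n) = 3"
    and domain: "open \<Omega>" "connected \<Omega>" "\<Omega> \<noteq> {}" "bounded \<Omega>" "lipschitz_boundary \<Omega>"
    and D: "D \<in> Linfty_space (lebesgue_on \<Omega>)" "0 < D\<^sub>0" "AE x in lebesgue_on \<Omega>. D\<^sub>0 \<le> D x"
    and \<mu>\<^sub>a: "\<mu>\<^sub>a \<in> L2_space (lebesgue_on \<Omega>)" "0 < \<mu>\<^sub>0" "AE x in lebesgue_on \<Omega>. \<mu>\<^sub>0 \<le> \<mu>\<^sub>a x"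
    and trace: "is_trace_operator \<Omega> \<gamma>\<^sub>0"
    and g1: "g1 \<in> trace_space \<Omega> D \<mu>\<^sub>a \<gamma>\<^sub>0" "g1\<delta> \<in> trace_space \<Omega> D \<mu>\<^sub>a \<gamma>\<^sub>0"
    and g2: "g2 \<in> dual_space \<Omega> D \<mu>\<^sub>a \<gamma>\<^sub>0" "g2\<delta> \<in> dual_space \<Omega> D \<mu>\<^sub>a \<gamma>\<^sub>0"
    and \<delta>: "0 < \<delta>"
    and noise: "trace_norm \<Omega> D \<mu>\<^sub>a \<gamma>\<^sub>0 (g1\<delta> - g1) + dual_norm \<Omega> D \<mu>\<^sub>a \<gamma>\<^sub>0 (g2\<delta> - g2) \<le> \<delta>"
    and y: "y = neumann_solution \<Omega> D \<mu>\<^sub>a \<gamma>\<^sub>0 g2 - dirichlet_solution \<Omega> D \<mu>\<^sub>a \<gamma>\<^sub>0 g1"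
    and y\<delta>: "y\<delta> = neumann_solution \<Omega> D \<mu>\<^sub>a \<gamma>\<^sub>0 g2\<delta> - dirichlet_solution \<Omega> D \<mu>\<^sub>a \<gamma>\<^sub>0 g1\<delta>"
  shows "V_norm \<Omega> D \<mu>\<^sub>a (y\<delta> - y) \<le> \<delta>"
proof -
  interpret traced_domain \<Omega> D \<mu>\<^sub>a D\<^sub>0 \<mu>\<^sub>0 \<gamma>\<^sub>0
    using domain D \<mu>\<^sub>a trace by unfold_locales (auto simp: Linfty_space_def L2_space_def)
  define uN where "uN = neumann_solution \<Omega> D \<mu>\<^sub>a \<gamma>\<^sub>0"
  define uD where "uD = dirichlet_solution \<Omega> D \<mu>\<^sub>a \<gamma>\<^sub>0"
  note neu = neumann_solution[folded uN_def] and dir = dirichlet_solution[folded uD_def]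
  have "N ((uN g2\<delta> - uN g2) - (uD g1\<delta> - uD g1)) \<le> \<delta>"
  proof (rule stability[where F = "g2\<delta> - g2" and g = "g1\<delta> - g1"])
    show "g2\<delta> - g2 \<in> T_dual" by (rule T_dual_diff[OF g2(2,1)])
    show "uN g2\<delta> - uN g2 \<in> V" by (rule V.diff[OF neu(1)[OF g2(2)] neu(1)[OF g2(1)]])
    show "E (uN g2\<delta> - uN g2) v = (g2\<delta> - g2) (\<gamma>\<^sub>0 v)" if "v \<in> V" for v
      using that by (simp add: V.diff_left neu g2)
    show "uD g1\<delta> - uD g1 \<in> V" by (rule V.diff[OF dir(1)[OF g1(2)] dir(1)[OF g1(1)]])
    show "E (uD g1\<delta> - uD g1) v = 0" if "v \<in> V0" for v
      using that by (simp add: V.diff_left dir g1 V0_subset)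
    show "AE x in S. \<gamma>\<^sub>0 (uD g1\<delta> - uD g1) x = (g1\<delta> - g1) x"
      using trace_diff[OF dir(1)[OF g1(2)] dir(1)[OF g1(1)]] dir(2)[OF g1(1)] dir(2)[OF g1(2)]
      by eventually_elim simp
  qed (use \<delta> noise in auto)
  moreover have "(uN g2\<delta> - uN g2) - (uD g1\<delta> - uD g1) = y\<delta> - y"
    unfolding y y\<delta> uN_def uD_def by (simp add: fun_eq_iff)
  ultimately show ?thesis by simp
qed

end
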